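(* Let $\mathfrak g$ be a symplectic filiform Lie algebra over $\mathbb R$ of dimension $2k\ge12$. Then one can choose a basis $e_1,\dots,e_{2k}$ of $\mathfrak g$ such that the commutation relations of $\mathfrak g$ are, for some constants $c_{ij}^l\in\mathbb R$, either $$[e_1,e_i]=e_{i+1}+\sum_{l=1}^{2k-i-1}c_{1i}^{l}e_{i+l+1},\quad i=2,\dots,2k-1;\qquad [e_i,e_j]=\sum_{l=1}^{2k-i-j}c_{ij}^l e_{i+j+l},\quad i+j\le 2k,\ 2\le i<j\le 2k;$$ or $$[e_i,e_j]=(j-i)e_{i+j}+\sum_{l=1}^{2k-i-j}c_{ij}^l e_{i+j+l},\quad i+j\le 2k,\ 1\le i<j\le 2k.$$
   Context: In each list, brackets $[e_i,e_j]$ with $i<j$ that are not listed are zero. An $n$-dimensional Lie algebra is filiform if it is nilpotent with nil-index $n-1$, i.e. $C^{n}\mathfrak g=0$ and $C^{n-1}\mathfrak g\neq0$, where $C^1\mathfrak g=\mathfrak g$, $C^{m}\mathfrak g=[\mathfrak g,C^{m-1}\mathfrak g]$. A Lie algebra is symplectic if it admits a non-degenerate skew-symmetric bilinear form $\omega$ with $\omega([x,y],z)+\omega([y,z],x)+\omega([z,x],y)=0$ for all $x,y,z$. *)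

theory Defs
  imports "HOL-Analysis.Analysis"
begin

text \<open>A real Lie algebra is a bracket on a type of class \<^class>\<open>real_vector\<close>; the underlying
  vector space is the whole type.\<close>

locale lie_algebra =
  fixes br :: "'a::real_vector \<Rightarrow> 'a \<Rightarrow> 'a"
  assumes bilinear_br: "bilinear br"
    and alternating: "br x x = 0"
    and jacobi: "br x (br y z) + br y (br z x) + br z (br x y) = 0"

text \<open>The numbering starts at \<open>C\<^sup>1 = \<gg>\<close>; the value at \<open>0\<close> is a dummy.\<close>

fun lower_central :: "('a::real_vector \<Rightarrow> 'a \<Rightarrow> 'a) \<Rightarrow> nat \<Rightarrow> 'a set" where
  "lower_central br 0 = UNIV"
| "lower_central br (Suc 0) = UNIV"
| "lower_central br (Suc (Suc m)) = span {br x y | x y. y \<in> lower_central br (Suc m)}"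

text \<open>Finite dimensionality is stated separately because \<^const>\<open>dim\<close> is \<open>0\<close> on
  infinite-dimensional spaces.\<close>

definition filiform :: "('a::real_vector \<Rightarrow> 'a \<Rightarrow> 'a) \<Rightarrow> bool" where
  "filiform br \<longleftrightarrow>
     (\<exists>B :: 'a set. finite B \<and> span B = UNIV) \<and>
     lower_central br (dim (UNIV :: 'a set)) = {0} \<and>
     lower_central br (dim (UNIV :: 'a set) - 1) \<noteq> {0}"

definition symplectic_form ::
    "('a::real_vector \<Rightarrow> 'a \<Rightarrow> 'a) \<Rightarrow> ('a \<Rightarrow> 'a \<Rightarrow> real) \<Rightarrow> bool" where
  "symplectic_form br \<omega> \<longleftrightarrow>
     bilinear \<omega> \<and>
     (\<forall>x y. \<omega> x y = - \<omega> y x) \<and>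
     (\<forall>x. (\<forall>y. \<omega> x y = 0) \<longrightarrow> x = 0) \<and>
     (\<forall>x y z. \<omega> (br x y) z + \<omega> (br y z) x + \<omega> (br z x) y = 0)"

definition symplectic :: "('a::real_vector \<Rightarrow> 'a \<Rightarrow> 'a) \<Rightarrow> bool" where
  "symplectic br \<longleftrightarrow> (\<exists>\<omega>. symplectic_form br \<omega>)"

definition is_basis :: "nat \<Rightarrow> (nat \<Rightarrow> 'a::real_vector) \<Rightarrow> bool" where
  "is_basis n e \<longleftrightarrow>
     inj_on e {1..n} \<and> independent (e ` {1..n}) \<and> span (e ` {1..n}) = UNIV"

text \<open>In both lists of relations, the last clauses express the convention that brackets
  \<open>[e\<^sub>i, e\<^sub>j]\<close>, \<open>i < j\<close>, that are not listed vanish.\<close>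

definition m0_type_relations ::
    "('a::real_vector \<Rightarrow> 'a \<Rightarrow> 'a) \<Rightarrow> nat \<Rightarrow> (nat \<Rightarrow> 'a) \<Rightarrow> (nat \<Rightarrow> nat \<Rightarrow> nat \<Rightarrow> real) \<Rightarrow> bool" where
  "m0_type_relations br n e c \<longleftrightarrow>
     (\<forall>i\<in>{2..n - 1}.
        br (e 1) (e i) = e (i + 1) + (\<Sum>l = 1..n - i - 1. c 1 i l *\<^sub>R e (i + l + 1))) \<and>
     (\<forall>i j. 2 \<le> i \<and> i < j \<and> j \<le> n \<and> i + j \<le> n \<longrightarrow>
        br (e i) (e j) = (\<Sum>l = 1..n - i - j. c i j l *\<^sub>R e (i + j + l))) \<and>
     br (e 1) (e n) = 0 \<and>
     (\<forall>i j. 2 \<le> i \<and> i < j \<and> j \<le> n \<and> n < i + j \<longrightarrow> br (e i) (e j) = 0)"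

definition witt_type_relations ::
    "('a::real_vector \<Rightarrow> 'a \<Rightarrow> 'a) \<Rightarrow> nat \<Rightarrow> (nat \<Rightarrow> 'a) \<Rightarrow> (nat \<Rightarrow> nat \<Rightarrow> nat \<Rightarrow> real) \<Rightarrow> bool" where
  "witt_type_relations br n e c \<longleftrightarrow>
     (\<forall>i j. 1 \<le> i \<and> i < j \<and> j \<le> n \<and> i + j \<le> n \<longrightarrow>
        br (e i) (e j) =
          (real j - real i) *\<^sub>R e (i + j) + (\<Sum>l = 1..n - i - j. c i j l *\<^sub>R e (i + j + l))) \<and>
     (\<forall>i j. 1 \<le> i \<and> i < j \<and> j \<le> n \<and> n < i + j \<longrightarrow> br (e i) (e j) = 0)"

end

theory Submission
  imports Defs
begin

text \<open>
A filiform Lie algebra of dimension \<open>n\<close> has a basis \<open>e\<^sub>1, \<dots>, e\<^sub>n\<close> adapted to its lower central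
series with \<open>[e\<^sub>1, e\<^sub>i] = e\<^sub>i\<^sub>+\<^sub>1\<close> for \<open>i \<ge> 2\<close> (\<open>adapted_basis_exists\<close>). The idea is to pass to graded
Lie algebras, where the brackets are scalars \<open>f i j\<close>, and where the Jacobi identity involving
\<open>e\<^sub>1\<close> becomes the linear recurrence \<open>f (i + 1) j + f i (j + 1) = f i j\<close>. This recurrence leaves
one free parameter for every odd weight \<open>i + j\<close>, and none for the even weights.

The lower central series gives a first graded algebra. The Jacobi identity makes all its brackets
among the \<open>e\<^sub>i\<close> with \<open>i \<ge> 2\<close> vanish except possibly those that land in the last line, and a symplectic
form excludes these too (\<open>sc_vanishes\<close>). Consequently \<open>[e\<^sub>i, e\<^sub>j]\<close> starts at \<open>e\<^sub>i\<^sub>+\<^sub>j\<close>, which gives a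
second graded algebra with \<open>e\<^sub>i\<close> in degree \<open>i\<close>; both conclusions of the theorem are statements about
it: either its constants \<open>f i j\<close> with \<open>i, j \<ge> 2\<close> are all zero or it is a truncated Witt algebra.

The symplectic form turns out to be triangular with respect to the antidiagonal, with leading part of
weight \<open>n + 1\<close> and nonzero antidiagonal entries. Its leading part is a cocycle, and so extends the
graded algebra by one more degree (\<open>extended_sc\<close>). In other words, the constants \<open>f\<close> are
defined up to the odd weight \<open>N = n + 1\<close>, satisfy the recurrence and the Jacobi relations up to \<open>N\<close>,
and do not vanish anywhere at the weight \<open>N\<close>. Such systems are classified by
\<open>graded_constants_classification\<close>: by the position \<open>2 * m + 1\<close> of the first nonzero weight, by
three quadratic equations of weight at most 12 in the first parameters, and by the fact that
afterwards the Jacobi relations determine each further parameter from the previous ones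
(\<open>determined_by_low_weights\<close>).
\<close>

section \<open>Graded structure constants\<close>

text \<open>If \<open>[e\<^sub>1, e\<^sub>i] = e\<^sub>i\<^sub>+\<^sub>1\<close> for \<open>i \<ge> 2\<close> and \<open>f i j\<close> is the coefficient of the leading term of
\<open>[e\<^sub>i, e\<^sub>j]\<close>, then these two conditions express that the bracket is antisymmetric and that
\<open>ad e\<^sub>1\<close> is a derivation of it. The total index \<open>i + j\<close> is called the weight, and \<open>N\<close> is the
largest weight at which \<open>f\<close> is meaningful.\<close>

definition derivation_recurrence :: "nat \<Rightarrow> (nat \<Rightarrow> nat \<Rightarrow> real) \<Rightarrow> bool" where
  "derivation_recurrence N f \<longleftrightarrow>
     (\<forall>i\<ge>2. \<forall>j\<ge>2. i + j \<le> N \<longrightarrow> f i j = - f j i) \<and>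
     (\<forall>i\<ge>2. \<forall>j\<ge>2. i + j < N \<longrightarrow> f (Suc i) j + f i (Suc j) = f i j)"

definition vanishes_at_weight :: "nat \<Rightarrow> (nat \<Rightarrow> nat \<Rightarrow> real) \<Rightarrow> bool" where
  "vanishes_at_weight w f \<longleftrightarrow> (\<forall>i\<ge>2. \<forall>j\<ge>2. i + j = w \<longrightarrow> f i j = 0)"

lemma derivation_recurrence_antisym:
  "derivation_recurrence N f \<Longrightarrow> 2 \<le> i \<Longrightarrow> 2 \<le> j \<Longrightarrow> i + j \<le> N \<Longrightarrow> f i j = - f j i"
  unfolding derivation_recurrence_def by blast

lemma derivation_recurrence_step:
  "derivation_recurrence N f \<Longrightarrow> 2 \<le> i \<Longrightarrow> 2 \<le> j \<Longrightarrow> i + j < N \<Longrightarrow>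
     f i (Suc j) = f i j - f (Suc i) j"
  unfolding derivation_recurrence_def by (metis add_diff_cancel_left')

lemma derivation_recurrence_diag:
  "derivation_recurrence N f \<Longrightarrow> 2 \<le> i \<Longrightarrow> i + i \<le> N \<Longrightarrow> f i i = 0"
  using derivation_recurrence_antisym[of N f i i] by simp

lemma derivation_recurrence_diff:
  assumes "derivation_recurrence N f" "derivation_recurrence N g"
  shows "derivation_recurrence N (\<lambda>i j. f i j - g i j)"
  unfolding derivation_recurrence_def
proof (intro conjI allI impI)
  fix i j :: nat assume *: "2 \<le> i" "2 \<le> j" "i + j \<le> N"
  show "f i j - g i j = - (f j i - g j i)"
    using derivation_recurrence_antisym[OF assms(1) *] derivation_recurrence_antisym[OF assms(2) *] by simp
next
  fix i j :: nat assume *: "2 \<le> i" "2 \<le> j" "i + j < N"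
  show "f (Suc i) j - g (Suc i) j + (f i (Suc j) - g i (Suc j)) = f i j - g i j"
    using derivation_recurrence_step[OF assms(1) *] derivation_recurrence_step[OF assms(2) *] by simp
qed

text \<open>Where the previous weight vanishes, the recurrence says that shifting one unit from one index to
the other changes the sign. Hence a single scalar, the entry next to the diagonal, controls the
whole weight.\<close>

lemma odd_weight_alternates:
  assumes rec: "derivation_recurrence N f" and N: "2 * m + 1 \<le> N"
    and zero: "vanishes_at_weight (2 * m) f"
  shows "2 \<le> i \<Longrightarrow> i + p = m \<Longrightarrow> f i (m + 1 + p) = (-1) ^ p * f m (m + 1)"
proof (induction p arbitrary: i)
  case (Suc p)
  have "f i (m + 1 + Suc p) = f i (m + 1 + p) - f (Suc i) (m + 1 + p)"
    using derivation_recurrence_step[OF rec, of i "m + 1 + p"] Suc.prems N by simp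
  moreover have "f i (m + 1 + p) = 0"
    using zero Suc.prems unfolding vanishes_at_weight_def by simp
  ultimately show ?case
    using Suc.IH[of "Suc i"] Suc.prems by simp
qed simp

lemma odd_weight_vanishes:
  assumes rec: "derivation_recurrence N f" and N: "2 * m + 1 \<le> N"
    and zero: "vanishes_at_weight (2 * m) f"
    and mid: "f m (m + 1) = 0"
  shows "vanishes_at_weight (2 * m + 1) f"
  unfolding vanishes_at_weight_def
proof (intro allI impI)
  fix i j :: nat assume ij: "2 \<le> i" "2 \<le> j" "i + j = 2 * m + 1"
  have *: "f a b = 0" if "2 \<le> a" "a \<le> m" "a + b = 2 * m + 1" for a b
  proof -
    have "b = m + 1 + (m - a)" using that by simp
    thus ?thesis
      using odd_weight_alternates[OF rec N zero, of a "m - a"] that mid by simp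
  qed
  show "f i j = 0"
  proof (cases "i \<le> m")
    case False
    then have "f j i = 0" using * ij by simp
    thus ?thesis using derivation_recurrence_antisym[OF rec ij(1,2)] ij N by simp
  qed (use * ij in simp)
qed

text \<open>At an even weight the alternating pattern passes through a diagonal entry, which is zero by
antisymmetry; so no free parameter appears there.\<close>

lemma even_weight_vanishes:
  assumes rec: "derivation_recurrence N f" and N: "2 * m \<le> N"
    and zero: "vanishes_at_weight (2 * m - 1) f"
  shows "vanishes_at_weight (2 * m) f"
  unfolding vanishes_at_weight_def
proof (intro allI impI)
  fix i j :: nat assume ij: "2 \<le> i" "2 \<le> j" "i + j = 2 * m"
  have *: "f a (m + p) = 0" if "2 \<le> a" "a + p = m" for a p
    using that
  proof (induction p arbitrary: a)
    case 0
    thus ?case using derivation_recurrence_diag[OF rec, of m] N by simp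
  next
    case (Suc p)
    have "f a (m + Suc p) = f a (m + p) - f (Suc a) (m + p)"
      using derivation_recurrence_step[OF rec, of a "m + p"] Suc.prems N by simp
    moreover have "f a (m + p) = 0"
      using zero Suc.prems unfolding vanishes_at_weight_def by simp
    ultimately show ?case
      using Suc.IH[of "Suc a"] Suc.prems by simp
  qed
  show "f i j = 0"
  proof (cases "i \<le> m")
    case True
    then have "j = m + (m - i)" using ij by simp
    thus ?thesis using *[of i "m - i"] ij True by simp
  next
    case False
    then have "i = m + (m - j)" using ij by simp
    then have "f j i = 0" using *[of j "m - j"] ij False by simp
    thus ?thesis using derivation_recurrence_antisym[OF rec ij(1,2)] ij N by simp
  qed
qed

text \<open>The next three lemmas integrate the recurrence from the diagonal outwards, starting at a first
nonzero weight \<open>2 * m + 1\<close>. At the weight \<open>2 * m + 3\<close> the entry \<open>f (m + 1) (m + 2)\<close> enters as a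
new free parameter; all entries are combinations of these two with binomial coefficients and
alternating signs.\<close>

lemma first_weight_after:
  assumes rec: "derivation_recurrence N f" and N: "2 * m + 2 \<le> N"
    and zero: "vanishes_at_weight (2 * m) f"
  shows "2 \<le> i \<Longrightarrow> i + p = m \<Longrightarrow> f i (m + 2 + p) = (-1) ^ p * real (p + 1) * f m (m + 1)"
proof (induction p arbitrary: i)
  case 0
  then show ?case
    using derivation_recurrence_step[OF rec, of m "m + 1"]
      derivation_recurrence_diag[OF rec, of "m + 1"] N by simp
next
  case (Suc p)
  have "f i (m + 2 + Suc p) = f i (m + 1 + Suc p) - f (Suc i) (m + 2 + p)"
    using derivation_recurrence_step[OF rec, of i "m + 2 + p"] Suc.prems N by simp
  moreover have "f i (m + 1 + Suc p) = (-1) ^ Suc p * f m (m + 1)"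
    using odd_weight_alternates[OF rec _ zero, of i "Suc p"] Suc.prems N by simp
  ultimately show ?case
    using Suc.IH[of "Suc i"] Suc.prems by (simp add: algebra_simps)
qed

lemma second_weight_after:
  assumes rec: "derivation_recurrence N f" and N: "2 * m + 3 \<le> N"
    and zero: "vanishes_at_weight (2 * m) f"
  shows "2 \<le> i \<Longrightarrow> i + p = m \<Longrightarrow>
    f i (m + 3 + p) =
      (-1) ^ p * ((real p + 1) * (real p + 2) / 2 * f m (m + 1) - f (m + 1) (m + 2))"
proof (induction p arbitrary: i)
  case 0
  then show ?case
    using derivation_recurrence_step[OF rec, of m "m + 2"]
      first_weight_after[OF rec _ zero, of m 0] N by (simp add: eval_nat_numeral(2,3))
next
  case (Suc p)
  have "f i (m + 3 + Suc p) = f i (m + 2 + Suc p) - f (Suc i) (m + 3 + p)"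
    using derivation_recurrence_step[OF rec, of i "m + 3 + p"] Suc.prems N
    by (simp add: numeral_3_eq_3)
  moreover have "f i (m + 2 + Suc p) = (-1) ^ Suc p * real (Suc p + 1) * f m (m + 1)"
    using first_weight_after[OF rec _ zero, of i "Suc p"] Suc.prems N by simp
  ultimately show ?case
    using Suc.IH[of "Suc i"] Suc.prems by (simp add: field_simps)
qed

lemma third_weight_after:
  assumes rec: "derivation_recurrence N f" and N: "2 * m + 4 \<le> N"
    and zero: "vanishes_at_weight (2 * m) f"
  shows "2 \<le> i \<Longrightarrow> i + p = m \<Longrightarrow>
    f i (m + 4 + p) =
      (-1) ^ p * ((real p + 1) * (real p + 2) * (real p + 3) / 6 * f m (m + 1)
                   - (real p + 2) * f (m + 1) (m + 2))"
proof (induction p arbitrary: i)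
  case 0
  then show ?case
    using derivation_recurrence_step[OF rec, of m "m + 3"]
      derivation_recurrence_step[OF rec, of "m + 1" "m + 2"]
      derivation_recurrence_diag[OF rec, of "m + 2"]
      second_weight_after[OF rec _ zero, of m 0] N by (simp add: eval_nat_numeral(2,3))
next
  case (Suc p)
  have "f i (m + 4 + Suc p) = f i (m + 3 + Suc p) - f (Suc i) (m + 4 + p)"
    using derivation_recurrence_step[OF rec, of i "m + 4 + p"] Suc.prems N by (simp add: ac_simps)
  moreover have "f i (m + 3 + Suc p) =
      (-1) ^ Suc p * ((real (Suc p) + 1) * (real (Suc p) + 2) / 2 * f m (m + 1) - f (m + 1) (m + 2))"
    using second_weight_after[OF rec _ zero, of i "Suc p"] Suc.prems N by simp
  ultimately show ?case
    using Suc.IH[of "Suc i"] Suc.prems by (simp add: field_simps)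
qed


definition jacobi_relation :: "(nat \<Rightarrow> nat \<Rightarrow> real) \<Rightarrow> nat \<Rightarrow> nat \<Rightarrow> nat \<Rightarrow> bool" where
  "jacobi_relation f i j l \<longleftrightarrow> f i j * f (i + j) l + f j l * f (j + l) i + f l i * f (l + i) j = 0"

text \<open>Free parameters occur only at odd weights, so the first nonzero weight is odd and is detected next
to the diagonal.\<close>

lemma first_nonzero_weight:
  assumes rec: "derivation_recurrence N f"
    and nz: "2 \<le> i" "2 \<le> j" "i + j \<le> M" "M \<le> N" "f i j \<noteq> 0"
  obtains m where "2 \<le> m" "2 * m + 1 \<le> M" "f m (m + 1) \<noteq> 0"
    "\<And>w. w \<le> 2 * m \<Longrightarrow> vanishes_at_weight w f"
proof -
  have ex: "\<not> vanishes_at_weight (i + j) f"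
    using nz unfolding vanishes_at_weight_def by blast
  define w where "w = (LEAST w. \<not> vanishes_at_weight w f)"
  have w: "\<not> vanishes_at_weight w f"
    unfolding w_def by (rule LeastI[of _ "i + j"]) (fact ex)
  have below: "vanishes_at_weight v f" if "v < w" for v
    using not_less_Least[of v "\<lambda>w. \<not> vanishes_at_weight w f"] that unfolding w_def by blast
  have "w \<le> i + j"
    unfolding w_def by (rule Least_le) (fact ex)
  then have wM: "w \<le> M" "w \<le> N" using nz by simp_all
  have w4: "4 \<le> w"
    using w unfolding vanishes_at_weight_def by (metis add_mono numeral_Bit0)
  have "odd w"
  proof
    assume "even w"
    then obtain m where m: "w = 2 * m" by blast
    then have "vanishes_at_weight (2 * m) f"
      using even_weight_vanishes[OF rec, of m] below[of "2 * m - 1"] w4 wM by simp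
    with w m show False by simp
  qed
  then obtain m where m: "w = 2 * m + 1" by (elim oddE)
  have "f m (m + 1) \<noteq> 0"
    using odd_weight_vanishes[OF rec, of m] below[of "2 * m"] w m wM by auto
  then show ?thesis
    using that[of m] m w4 wM below by simp
qed

text \<open>At the first weight \<open>2 * m + 1\<close> where two solutions of the recurrence differ, their difference
alternates in sign with amplitude \<open>\<delta>\<close>, say. The Jacobi relation for \<open>2, 3, 2 * m - 4\<close> is linear in
\<open>\<delta>\<close> there, and the three signs happen to coincide: it says that \<open>\<delta> * (g 2 3 + g 3 l + g 2 l)\<close>
is zero for \<open>l = 2 * m - 4\<close>. So one solution of the Jacobi relations determines the other from
the two parameters that come before the first such relation.\<close>

lemma determined_by_low_weights:
  assumes f: "derivation_recurrence N f" and g: "derivation_recurrence N g"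
    and low: "f 2 3 = g 2 3" "f 3 4 = g 3 4"
    and jf: "\<And>l. 4 \<le> l \<Longrightarrow> 5 + l \<le> N \<Longrightarrow> jacobi_relation f 2 3 l"
    and jg: "\<And>l. 4 \<le> l \<Longrightarrow> 5 + l \<le> N \<Longrightarrow> jacobi_relation g 2 3 l"
    and sum_nz: "\<And>l. 4 \<le> l \<Longrightarrow> 5 + l \<le> N \<Longrightarrow> g 2 3 + g 3 l + g 2 l \<noteq> 0"
    and ij: "2 \<le> i" "2 \<le> j" "i + j \<le> N"
  shows "f i j = g i j"
proof (rule ccontr)
  define d where "d = (\<lambda>i j. f i j - g i j)"
  have d: "derivation_recurrence N d"
    unfolding d_def by (rule derivation_recurrence_diff[OF f g])
  assume "f i j \<noteq> g i j"
  then have "d i j \<noteq> 0" unfolding d_def by simp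
  then obtain m where m: "2 \<le> m" "2 * m + 1 \<le> N" "d m (m + 1) \<noteq> 0"
    and van: "\<And>w. w \<le> 2 * m \<Longrightarrow> vanishes_at_weight w d"
    using first_nonzero_weight[OF d ij order_refl] by blast
  have eq: "f a b = g a b" if "2 \<le> a" "2 \<le> b" "a + b \<le> 2 * m" for a b
    using van[of "a + b"] that unfolding vanishes_at_weight_def d_def by simp
  have "m \<noteq> 2" "m \<noteq> 3" using m(3) low unfolding d_def by auto
  then have "4 \<le> m" using m(1) by linarith
  then obtain h where h: "m = h + 4" by (metis add.commute le_Suc_ex)
  have alt: "d a (m + 1 + p) = (-1) ^ p * d m (m + 1)" if "2 \<le> a" "a + p = m" for a p
    using odd_weight_alternates[OF d m(2) van[OF order_refl] that] .
  define l where "l = 2 * m - 4"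
  have l: "4 \<le> l" "5 + l \<le> N" using m h unfolding l_def by simp_all
  have "jacobi_relation f 2 3 l" "jacobi_relation g 2 3 l"
    using jf jg l by blast+
  moreover have "f 2 3 = g 2 3" "f 3 l = g 3 l" "f l 2 = g l 2"
    using eq h unfolding l_def by simp_all
  \<comment> \<open>Only the second factors have weight \<open>2 * m + 1\<close>; the first factors agree for \<open>f\<close> and \<open>g\<close>.\<close>
  ultimately have *: "g 2 3 * d 5 l + g 3 l * d (3 + l) 2 + g l 2 * d (l + 2) 3 = 0"
    unfolding jacobi_relation_def d_def by (simp add: algebra_simps)
  have "d 2 (3 + l) = (-1) ^ (m - 2) * d m (m + 1)"
    using alt[of 2 "m - 2"] h unfolding l_def by simp
  moreover have "d 3 (l + 2) = (-1) ^ (m - 3) * d m (m + 1)"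
    using alt[of 3 "m - 3"] h unfolding l_def by simp
  moreover have "d 5 l = (-1) ^ (m - 5) * d m (m + 1)" if "m \<noteq> 4"
    using alt[of 5 "m - 5"] h that unfolding l_def by simp
  \<comment> \<open>For \<open>m = 4\<close> the entry \<open>d 5 l\<close> lies on the other side of the diagonal.\<close>
  moreover have "d 5 4 = - d 4 5"
    using derivation_recurrence_antisym[OF d, of 5 4] m h by simp
  moreover have "d (3 + l) 2 = - d 2 (3 + l)" "d (l + 2) 3 = - d 3 (l + 2)"
    using derivation_recurrence_antisym[OF d, of _ 2] derivation_recurrence_antisym[OF d, of _ 3] l
    by simp_all
  moreover have "g l 2 = - g 2 l"
    using derivation_recurrence_antisym[OF g, of l 2] l by simp
  ultimately have "(g 2 3 + g 3 l + g 2 l) * ((-1) ^ h * d m (m + 1)) = 0"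
    using * h by (cases h) (auto simp: l_def algebra_simps power_add)
  then show False using sum_nz[OF l] m(3) by simp
qed


text \<open>The positive part of the Witt algebra has the brackets \<open>[L\<^sub>i, L\<^sub>j] = (j - i) L\<^sub>i\<^sub>+\<^sub>j\<close>. These are
its constants in the basis \<open>e\<^sub>1 = L\<^sub>1\<close>, \<open>e\<^sub>i = (i - 2)! L\<^sub>i\<close> for \<open>i \<ge> 2\<close>, in which \<open>ad e\<^sub>1\<close> is the
shift.\<close>

definition witt_constant :: "nat \<Rightarrow> nat \<Rightarrow> real" where
  "witt_constant i j = (real j - real i) * fact (i - 2) * fact (j - 2) / fact (i + j - 2)"

lemma derivation_recurrence_witt: "derivation_recurrence N (\<lambda>i j. c * witt_constant i j)"
  unfolding derivation_recurrence_def
proof (intro conjI allI impI)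
  fix i j :: nat
  show "c * witt_constant i j = - (c * witt_constant j i)"
    by (simp add: witt_constant_def add.commute field_simps)
next
  fix i j :: nat assume "2 \<le> i" "2 \<le> j"
  then obtain a b where ab: "i = a + 2" "j = b + 2" by (metis add.commute le_Suc_ex)
  have "witt_constant (Suc i) j + witt_constant i (Suc j) = witt_constant i j"
    unfolding witt_constant_def ab
    by (simp add: divide_simps) (simp add: algebra_simps)
  then show "c * witt_constant (Suc i) j + c * witt_constant i (Suc j) = c * witt_constant i j"
    by (metis distrib_left)
qed

lemma jacobi_relation_witt: "jacobi_relation (\<lambda>i j. c * witt_constant i j) i j l"
proof -
  \<comment> \<open>The middle factorials cancel; what remains is the cyclic identity for \<open>(q - p) (r - p - q)\<close>.\<close>
  have prod: "witt_constant p q * witt_constant (p + q) r =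
      (real q - real p) * (real r - real p - real q) * fact (p - 2) * fact (q - 2) * fact (r - 2)
        / fact (p + q + r - 2)" for p q r
    by (simp add: witt_constant_def)
  have "witt_constant i j * witt_constant (i + j) l + witt_constant j l * witt_constant (j + l) i
      + witt_constant l i * witt_constant (l + i) j = 0"
    unfolding prod
    by (simp add: add.commute add.left_commute diff_divide_distrib[symmetric] add_divide_distrib[symmetric])
       (simp add: algebra_simps)
  then have "c * c * (witt_constant i j * witt_constant (i + j) l + witt_constant j l * witt_constant (j + l) i
      + witt_constant l i * witt_constant (l + i) j) = 0"
    by simp
  then show ?thesis
    unfolding jacobi_relation_def by (simp add: algebra_simps)
qed

text \<open>The graded algebra in which \<open>e\<^sub>2\<close> acts as a shift by two and all brackets among the \<open>e\<^sub>i\<close> with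
\<open>i \<ge> 3\<close> vanish. It satisfies all Jacobi relations, so only nondegeneracy can exclude it.\<close>

definition truncated_shift_constant :: "nat \<Rightarrow> nat \<Rightarrow> real" where
  "truncated_shift_constant i j =
     (if i = 2 \<and> 3 \<le> j then 1 else if j = 2 \<and> 3 \<le> i then -1 else 0)"

lemma derivation_recurrence_truncated_shift:
  "derivation_recurrence N (\<lambda>i j. c * truncated_shift_constant i j)"
  unfolding derivation_recurrence_def truncated_shift_constant_def by auto

text \<open>The recurrence makes every entry of weight at most 12 an integer combination of the four entries
next to the diagonal. The Jacobi relations for \<open>(2, 3, 4)\<close>, \<open>(2, 4, 5)\<close> and \<open>(3, 4, 5)\<close> become
three quadratic equations in these four unknowns; they are the reason for the dimension bound.\<close>

lemma low_weight_relations: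
  assumes rec: "derivation_recurrence N f" and N: "12 \<le> N"
    and jac: "\<And>i j l. 2 \<le> i \<Longrightarrow> 2 \<le> j \<Longrightarrow> 2 \<le> l \<Longrightarrow> i + j + l \<le> N \<Longrightarrow> jacobi_relation f i j l"
  defines "a \<equiv> f 2 3" and "b \<equiv> f 3 4" and "c \<equiv> f 4 5" and "d \<equiv> f 5 6"
  shows "(2 * a + b) * c = 3 * b * b"
    and "4 * b * c - 6 * c * c = (2 * a - b - c) * d"
    and "4 * c * c = 3 * (b + c) * d"
proof -
  note step = derivation_recurrence_step[OF rec]
  note anti = derivation_recurrence_antisym[OF rec]
  note diag = derivation_recurrence_diag[OF rec]
  have D: "f 3 3 = 0" "f 4 4 = 0" "f 5 5 = 0" "f 6 6 = 0" using diag N by simp_all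
  have w6: "f 2 4 = a" using step[of 2 3] D N unfolding a_def by simp
  have w7: "f 2 5 = a - b" using step[of 2 4] w6 N unfolding b_def by simp
  have w8: "f 3 5 = b" "f 2 6 = a - 2 * b"
    using step[of 3 4] step[of 2 5] D w7 N unfolding b_def by simp_all
  have w9: "f 3 6 = b - c" "f 2 7 = a - 3 * b + c"
    using step[of 3 5] step[of 2 6] w8 N unfolding c_def by simp_all
  have w10: "f 4 6 = c" "f 3 7 = b - 2 * c"
    using step[of 4 5] step[of 3 6] D w9 N unfolding c_def by simp_all
  have w10': "f 2 8 = a - 4 * b + 3 * c"
    using step[of 2 7] w9 w10 N by simp
  have w11: "f 4 7 = c - d" "f 3 8 = b - 3 * c + d"
    using step[of 4 6] step[of 3 7] w10 N unfolding d_def by simp_all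
  have w11': "f 2 9 = a - 5 * b + 6 * c - d"
    using step[of 2 8] w10' w11 N by simp
  have w12: "f 5 7 = d" "f 4 8 = c - 2 * d"
    using step[of 5 6] step[of 4 7] w11 D N unfolding d_def by simp_all
  have w12': "f 3 9 = b - 4 * c + 3 * d"
    using step[of 3 8] w11 w12 N by simp
  have J: "jacobi_relation f 2 3 4" "jacobi_relation f 2 4 5" "jacobi_relation f 3 4 5"
    using jac N by simp_all
  have A: "f 5 4 = - c" "f 7 2 = - f 2 7" "f 4 2 = - a" "f 6 3 = - f 3 6"
      "f 6 5 = - d" "f 9 2 = - f 2 9" "f 5 2 = - f 2 5" "f 7 4 = - f 4 7"
      "f 7 5 = - f 5 7" "f 9 3 = - f 3 9" "f 5 3 = - f 3 5" "f 8 4 = - f 4 8"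
    using anti[of 5 4] anti[of 7 2] anti[of 4 2] anti[of 6 3] anti[of 6 5] anti[of 9 2]
      anti[of 5 2] anti[of 7 4] anti[of 7 5] anti[of 9 3] anti[of 5 3] anti[of 8 4] w6 N
    unfolding c_def d_def by simp_all
  show "(2 * a + b) * c = 3 * b * b"
    using J(1) A w6 w9 unfolding jacobi_relation_def a_def[symmetric] b_def[symmetric]
    by (simp add: algebra_simps a_def[symmetric] b_def[symmetric] c_def[symmetric])
  show "4 * b * c - 6 * c * c = (2 * a - b - c) * d"
    using J(2) A w6 w7 w11 w11' unfolding jacobi_relation_def
    by (simp add: algebra_simps a_def[symmetric] b_def[symmetric] c_def[symmetric] d_def[symmetric])
  show "4 * c * c = 3 * (b + c) * d"
    using J(3) A w8 w12 w12' unfolding jacobi_relation_def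
    by (simp add: algebra_simps a_def[symmetric] b_def[symmetric] c_def[symmetric] d_def[symmetric])
qed

text \<open>The last two equations are linear in \<open>d\<close>. Eliminating it, and then \<open>b * b\<close> by the first
equation, leaves \<open>b = 7 * c\<close>, and the first equation turns this into the value of the Witt
algebra.\<close>

lemma ratio_of_first_parameters:
  fixes a b c d :: real
  assumes e9: "(2 * a + b) * c = 3 * b * b"
    and e11: "4 * b * c - 6 * c * c = (2 * a - b - c) * d"
    and e12: "4 * c * c = 3 * (b + c) * d"
    and nz: "a \<noteq> 0" "b \<noteq> 0"
  shows "a = 10 * b"
proof -
  have c: "c \<noteq> 0" using e9 nz by auto
  have d: "d \<noteq> 0" using e12 c by auto
  have "4 * (2 * a - b - c) * (c * c) = (2 * a - b - c) * (3 * (b + c) * d)"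
    using arg_cong[OF e12, of "\<lambda>x. (2 * a - b - c) * x"] by (simp add: algebra_simps)
  also have "\<dots> = 3 * (b + c) * (4 * b * c - 6 * c * c)"
    using e11 by simp
  finally have "c * (4 * (2 * a - b - c) * c) = c * (3 * (b + c) * (4 * b - 6 * c))"
    by (simp add: algebra_simps)
  then have 1: "4 * (2 * a - b - c) * c = 3 * (b + c) * (4 * b - 6 * c)"
    using c by simp
  have "8 * a * c - 4 * b * c - 4 * c * c = 12 * b * b - 6 * b * c - 18 * c * c"
    using 1 by (simp add: algebra_simps)
  moreover have "12 * b * b = 8 * a * c + 4 * b * c"
    using e9 by (simp add: algebra_simps)
  ultimately have "c * (14 * c) = c * (2 * b)" by (simp add: algebra_simps)
  then have "b = 7 * c" using c by simp
  then show ?thesis using e9 c by (simp add: algebra_simps)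
qed

text \<open>Suppose that \<open>f\<close> is nonzero below the top weight and let \<open>2 * m + 1\<close> be its first nonzero weight.

For \<open>m \<ge> 4\<close> and \<open>l < m\<close>, two of the products in the Jacobi relation for \<open>(m, m + 1, l)\<close> have a
factor of weight below \<open>2 * m + 1\<close>, so that the third one gives \<open>f l (2 * m + 1) = 0\<close>.
If the top weight is \<open>2 * m + 3\<close>, then \<open>l = 2\<close> contradicts
nondegeneracy at the top; otherwise \<open>l = 2\<close> and \<open>l = 3\<close> prescribe two different values of the
ratio of \<open>f (m + 1) (m + 2)\<close> and \<open>f m (m + 1)\<close>. For \<open>m = 3\<close> the low weight relations are
inconsistent. For \<open>m = 2\<close> they leave two values of the ratio of \<open>f 3 4\<close> and \<open>f 2 3\<close>, and \<open>f\<close> is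
determined from there on: one value gives the truncated shift, which is zero at the top entry
\<open>(3, N - 3)\<close>, and the other one the Witt algebra.\<close>

theorem graded_constants_classification:
  assumes rec: "derivation_recurrence N f" and N: "odd N" "13 \<le> N"
    and jac: "\<And>i j l. 2 \<le> i \<Longrightarrow> 2 \<le> j \<Longrightarrow> 2 \<le> l \<Longrightarrow> i + j + l \<le> N \<Longrightarrow> jacobi_relation f i j l"
    and top: "\<And>i. 2 \<le> i \<Longrightarrow> i + 2 \<le> N \<Longrightarrow> f i (N - i) \<noteq> 0"
  obtains "\<And>i j. 2 \<le> i \<Longrightarrow> 2 \<le> j \<Longrightarrow> i + j < N \<Longrightarrow> f i j = 0"
  | c where "c \<noteq> 0" "\<And>i j. 2 \<le> i \<Longrightarrow> 2 \<le> j \<Longrightarrow> i + j \<le> N \<Longrightarrow> f i j = c * witt_constant i j"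
proof (cases "\<exists>i j. 2 \<le> i \<and> 2 \<le> j \<and> i + j < N \<and> f i j \<noteq> 0")
  case False
  then show ?thesis using that(1) by blast
next
  case True
  then obtain i j where ij: "2 \<le> i" "2 \<le> j" "i + j \<le> N - 1" "f i j \<noteq> 0" by auto
  obtain m where m: "2 \<le> m" "2 * m + 1 \<le> N - 1" "f m (m + 1) \<noteq> 0"
    and van: "\<And>w. w \<le> 2 * m \<Longrightarrow> vanishes_at_weight w f"
    using first_nonzero_weight[OF rec ij(1-3) _ ij(4)] N by auto
  have m3: "2 * m + 3 \<le> N" using m(2) N by presburger
  have zero: "f a b = 0" if "2 \<le> a" "2 \<le> b" "a + b \<le> 2 * m" for a b
    using van[of "a + b"] that unfolding vanishes_at_weight_def by blast
  note low = low_weight_relations[OF rec _ jac]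
  have "m < 4"
  proof (rule ccontr)
    assume "\<not> m < 4"
    then have m4: "4 \<le> m" by simp
    have kill: "f l (2 * m + 1) = 0" if "2 \<le> l" "l < m" "2 * m + 1 + l \<le> N" for l
    proof -
      have "jacobi_relation f m (m + 1) l" using jac that m4 by simp
      moreover have "f (m + 1) l = 0" "f l m = 0" using zero that m4 by simp_all
      ultimately have "f (2 * m + 1) l = 0"
        using m(3) unfolding jacobi_relation_def by (simp add: mult_2)
      then show ?thesis
        using derivation_recurrence_antisym[OF rec, of "2 * m + 1" l] that by simp
    qed
    have "N \<noteq> 2 * m + 3" using kill[of 2] top[of 2] m4 by auto
    then have N5: "2 * m + 5 \<le> N" using m3 N by presburger
    define a where "a = f m (m + 1)"
    define b where "b = f (m + 1) (m + 2)"
    define x where "x = real m"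
    have "f 2 (m + 3 + (m - 2)) = 0" using kill[of 2] m4 N5 by simp
    then have 1: "(x - 1) * x / 2 * a = b"
      using second_weight_after[OF rec m3 van[OF order_refl], of 2 "m - 2"] m4
      unfolding a_def b_def x_def by (simp add: of_nat_diff)
    have idx: "m + 4 + (m - 3) = 2 * m + 1" using m4 by simp
    have "f 3 (m + 4 + (m - 3)) = 0" unfolding idx using kill[of 3] m4 N5 by simp
    then have 2: "(x - 2) * (x - 1) * x / 6 * a = (x - 1) * b"
      using third_weight_after[OF rec _ van[OF order_refl], of 3 "m - 3"] m4 N5
      unfolding a_def b_def x_def by (simp add: of_nat_diff)
    have "x * (x - 1) * a * ((x - 2) / 6) = x * (x - 1) * a * ((x - 1) / 2)"
      using 2 unfolding 1[symmetric] by (simp add: field_simps)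
    moreover have "x * (x - 1) * a \<noteq> 0" using m m4 unfolding x_def a_def by simp
    ultimately have "(x - 2) / 6 = (x - 1) / 2" by (metis mult_left_cancel)
    then show False using m4 unfolding x_def by simp
  qed
  moreover have "m \<noteq> 3"
  proof
    assume m3: "m = 3"
    then have a: "f 2 3 = 0" and b: "f 3 4 \<noteq> 0" using zero[of 2 3] m(3) by simp_all
    define b' c' d' where "b' = f 3 4" and "c' = f 4 5" and "d' = f 5 6"
    note L = low[unfolded a, folded b'_def c'_def d'_def]
    have "c' = 3 * b'" using L(1) b N unfolding b'_def[symmetric] by simp
    then have "d' = 3 * b'" "b' * (42 * b') = b' * (4 * d')"
      using L(2,3) b N unfolding b'_def[symmetric] by (simp_all add: algebra_simps)
    then show False using b unfolding b'_def[symmetric] by simp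
  qed
  ultimately have m2: "m = 2" using m(1) by simp
  define a where "a = f 2 3"
  have a: "a \<noteq> 0" using m(3) m2 unfolding a_def by simp
  have "f 3 4 = 0 \<or> a = 10 * f 3 4"
    using ratio_of_first_parameters[OF low] a N unfolding a_def by force
  then show ?thesis
  proof
    assume b: "f 3 4 = 0"
    have eq: "f i j = a * truncated_shift_constant i j" if "2 \<le> i" "2 \<le> j" "i + j \<le> N" for i j
    proof (rule determined_by_low_weights[OF rec derivation_recurrence_truncated_shift])
      fix l :: nat assume l: "4 \<le> l" "5 + l \<le> N"
      show "jacobi_relation f 2 3 l" using jac l by simp
      show "jacobi_relation (\<lambda>i j. a * truncated_shift_constant i j) 2 3 l"
        using l unfolding jacobi_relation_def truncated_shift_constant_def by simp
      show "a * truncated_shift_constant 2 3 + a * truncated_shift_constant 3 l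
          + a * truncated_shift_constant 2 l \<noteq> 0"
        using l a unfolding truncated_shift_constant_def by simp
    qed (use that b in \<open>simp_all add: a_def truncated_shift_constant_def\<close>)
    have "f 3 (N - 3) = 0"
      using eq[of 3 "N - 3"] N unfolding truncated_shift_constant_def by auto
    then show ?thesis using top[of 3] N by simp
  next
    assume b: "a = 10 * f 3 4"
    have w: "witt_constant 2 3 = 1 / 6" "witt_constant 3 4 = 1 / 60"
      unfolding witt_constant_def by (simp_all add: fact_numeral)
    have eq: "f i j = 6 * a * witt_constant i j" if "2 \<le> i" "2 \<le> j" "i + j \<le> N" for i j
    proof (rule determined_by_low_weights[OF rec derivation_recurrence_witt])
      fix l :: nat assume l: "4 \<le> l" "5 + l \<le> N"
      show "jacobi_relation f 2 3 l" using jac l by simp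
      show "jacobi_relation (\<lambda>i j. 6 * a * witt_constant i j) 2 3 l"
        by (rule jacobi_relation_witt)
      have "witt_constant 2 3 + witt_constant 3 l + witt_constant 2 l > 0"
        using l unfolding witt_constant_def by (intro add_pos_pos divide_pos_pos mult_pos_pos) auto
      then show "6 * a * witt_constant 2 3 + 6 * a * witt_constant 3 l + 6 * a * witt_constant 2 l \<noteq> 0"
        using a by (metis distrib_left less_irrefl mult_eq_0_iff zero_neq_numeral)
    qed (use that b w in \<open>simp_all add: a_def\<close>)
    then show ?thesis using that(2)[of "6 * a"] a by simp
  qed
qed

section \<open>Adapted bases of filiform Lie algebras\<close>

text \<open>A line through a point outside one of the subspaces, in a direction outside all the others, meets
each of these others at most once; an infinite field leaves a parameter over.\<close>

lemma avoid_finitely_many_proper_subspaces: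
  fixes X :: "'i \<Rightarrow> 'a::real_vector set"
  assumes "finite I" "\<And>i. i \<in> I \<Longrightarrow> subspace (X i)" "\<And>i. i \<in> I \<Longrightarrow> X i \<noteq> UNIV"
  shows "\<exists>v. \<forall>i\<in>I. v \<notin> X i"
  using assms
proof (induction I)
  case (insert k I)
  obtain v where v: "\<forall>i\<in>I. v \<notin> X i" using insert by auto
  obtain w where w: "w \<notin> X k" using insert.prems(2)[of k] by auto
  show ?case
  proof (cases "v \<in> X k")
    case True
    define T where "T i = {t. w + t *\<^sub>R v \<in> X i}" for i
    have "finite (T i)" if i: "i \<in> I" for i
    proof -
      have sub: "subspace (X i)" using insert.prems i by simp
      have "t = t'" if "t \<in> T i" "t' \<in> T i" for t t'
      proof (rule ccontr)
        assume "t \<noteq> t'"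
        have "(w + t *\<^sub>R v) - (w + t' *\<^sub>R v) \<in> X i"
          using that unfolding T_def by (intro subspace_diff[OF sub]) auto
        then have "(t - t') *\<^sub>R v \<in> X i" by (simp add: algebra_simps)
        then have "inverse (t - t') *\<^sub>R (t - t') *\<^sub>R v \<in> X i" by (rule subspace_scale[OF sub])
        then show False using \<open>t \<noteq> t'\<close> v i by simp
      qed
      then have "T i = {} \<or> (\<exists>t. T i = {t})" by blast
      then show ?thesis by auto
    qed
    then have "finite (\<Union>i\<in>I. T i)" using insert.hyps(1) by simp
    then obtain t where t: "t \<notin> (\<Union>i\<in>I. T i)"
      using ex_new_if_finite[OF infinite_UNIV_char_0] by blast
    have "w + t *\<^sub>R v \<notin> X k"
    proof
      assume "w + t *\<^sub>R v \<in> X k"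
      then have "w + t *\<^sub>R v - t *\<^sub>R v \<in> X k"
        using True insert.prems(1)[of k] by (intro subspace_diff subspace_scale) auto
      then show False using w by simp
    qed
    then show ?thesis using t unfolding T_def by auto
  qed (use v in auto)
qed simp

lemma independent_of_dimension_spans:
  fixes S :: "'a::real_vector set"
  assumes B: "finite B" "span B = (UNIV :: 'a set)"
    and S: "independent S" "finite S" "card S = dim (UNIV :: 'a set)"
  shows "span S = UNIV"
proof (rule ccontr)
  assume "span S \<noteq> UNIV"
  then obtain w where w: "w \<notin> span S" by blast
  then have ind: "independent (insert w S)" using S(1) by (rule independent_insertI)
  obtain D :: "'a set" where D: "independent D" "span D = UNIV"
    using maximal_independent_subset[of "UNIV :: 'a set"] by (metis top.extremum_uniqueI)
  have "finite D" using independent_span_bound[OF B(1) D(1)] B(2) by simp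
  moreover have "card D = dim (UNIV :: 'a set)" using basis_card_eq_dim[of D UNIV] D by simp
  ultimately have "card (insert w S) \<le> dim (UNIV :: 'a set)"
    using independent_span_bound[OF _ ind, of D] D(2) by simp
  moreover have "w \<notin> S" using w span_base by blast
  ultimately show False using S(2,3) by simp
qed

text \<open>A strictly decreasing chain of subspaces with as many steps as the dimension drops by exactly one
dimension at each step. This replaces a computation of the dimensions of the single members: any
choice of one vector per step is a basis adapted to the whole chain.\<close>

lemma flag_basis:
  fixes F :: "nat \<Rightarrow> 'a::real_vector set" and u :: "nat \<Rightarrow> 'a"
  assumes B: "finite B" "span B = (UNIV :: 'a set)" and n: "dim (UNIV :: 'a set) = n"
    and sub: "\<And>m. subspace (F m)" and dec: "\<And>m. F (Suc m) \<subseteq> F m"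
    and last: "F (Suc n) = {0}"
    and u: "\<And>m. 1 \<le> m \<Longrightarrow> m \<le> n \<Longrightarrow> u m \<in> F m" "\<And>m. 1 \<le> m \<Longrightarrow> m \<le> n \<Longrightarrow> u m \<notin> F (Suc m)"
  shows "is_basis n u" and "\<And>m. 1 \<le> m \<Longrightarrow> m \<le> Suc n \<Longrightarrow> F m = span (u ` {m..n})"
proof -
  have mono: "F q \<subseteq> F p" if "p \<le> q" for p q
    using lift_Suc_antimono_le[of F, OF dec that] .
  have sup: "span (u ` {m..n}) \<subseteq> F m" if "1 \<le> m" for m
  proof (intro span_minimal sub image_subsetI)
    fix i assume "i \<in> {m..n}"
    then show "u i \<in> F m" using u(1)[of i] mono[of m i] that by auto
  qed
  have split: "u ` {m..n} = insert (u m) (u ` {Suc m..n})" if "m \<le> n" for m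
    using that by (simp add: atLeastAtMost_insertL[symmetric])
  have ind: "m \<le> Suc n \<Longrightarrow> 1 \<le> m \<Longrightarrow> independent (u ` {m..n}) \<and> inj_on u {m..n}" for m
  proof (induction m rule: inc_induct)
    case (step m)
    have notin: "u m \<notin> span (u ` {Suc m..n})"
      using sup[of "Suc m"] u(2)[of m] step by auto
    have "u m \<notin> u ` {Suc m..n}" using notin by (meson span_base)
    moreover have "{m..n} = insert m {Suc m..n}" using step by auto
    ultimately show ?case
      using step notin split[of m] independent_insertI[OF notin] by auto
  qed (simp add: independent_empty)
  have "card (u ` {1..n}) = n" using ind[of 1] by (simp add: card_image)
  then have spans: "span (u ` {1..n}) = UNIV"
    using independent_of_dimension_spans[OF B] ind[of 1] n by simp
  then show "is_basis n u" unfolding is_basis_def using ind[of 1] by simp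
  fix m assume m: "1 \<le> m" "m \<le> Suc n"
  have "F m \<subseteq> span (u ` {j..n})" if "1 \<le> j" "j \<le> m" for j
    using that
  proof (induction j rule: dec_induct)
    case base
    show ?case using spans by simp
  next
    case (step j)
    show ?case
    proof
      fix x assume x: "x \<in> F m"
      then have "x \<in> span (insert (u j) (u ` {Suc j..n}))"
        using step split[of j] m by auto
      then obtain a where a: "x - a *\<^sub>R u j \<in> span (u ` {Suc j..n})"
        unfolding span_breakdown_eq by blast
      have xj: "x \<in> F (Suc j)" using x mono[of "Suc j" m] step by auto
      have "a = 0"
      proof (rule ccontr)
        assume "a \<noteq> 0"
        have "x - a *\<^sub>R u j \<in> F (Suc j)" using a sup[of "Suc j"] by auto
        then have "x - (x - a *\<^sub>R u j) \<in> F (Suc j)" by (rule subspace_diff[OF sub xj])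
        then have "a *\<^sub>R u j \<in> F (Suc j)" by simp
        then have "inverse a *\<^sub>R a *\<^sub>R u j \<in> F (Suc j)" by (rule subspace_scale[OF sub])
        then show False using \<open>a \<noteq> 0\<close> u(2)[of j] step m by simp
      qed
      then show "x \<in> span (u ` {Suc j..n})" using a by simp
    qed
  qed
  then show "F m = span (u ` {m..n})" using m sup[of m] by blast
qed

context lie_algebra
begin

lemmas br_left = bilinear_ladd[OF bilinear_br] bilinear_lsub[OF bilinear_br]
  bilinear_lmul[OF bilinear_br] bilinear_lneg[OF bilinear_br] bilinear_lzero[OF bilinear_br]

lemmas br_right = bilinear_radd[OF bilinear_br] bilinear_rsub[OF bilinear_br]
  bilinear_rmul[OF bilinear_br] bilinear_rneg[OF bilinear_br] bilinear_rzero[OF bilinear_br]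

lemma br_antisym: "br x y = - br y x"
proof -
  have "br (x + y) (x + y) = br x x + br y x + (br x y + br y y)"
    by (simp only: br_left br_right)
  then show ?thesis by (simp add: alternating eq_neg_iff_add_eq_0 add.commute)
qed

lemma br_derivation: "br x (br y z) = br (br x y) z + br y (br x z)"
proof -
  have "br (br x y) z = - br z (br x y)" "br y (br x z) = - br y (br z x)"
    using br_antisym[of "br x y" z] br_antisym[of x z] by (simp_all add: br_right)
  moreover have "br x (br y z) = - br y (br z x) - br z (br x y)"
    using jacobi[of x y z] by (metis add_diff_cancel_right' diff_0 add_uminus_conv_diff diff_diff_eq2 add.commute minus_diff_eq)
  ultimately show ?thesis by simp
qed

lemma jacobi_left: "br (br x y) z + br (br y z) x + br (br z x) y = 0"
proof -
  have "br (br x y) z + br (br y z) x + br (br z x) y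
      = - br z (br x y) + - br x (br y z) + - br y (br z x)"
    using br_antisym[of "br x y" z] br_antisym[of "br y z" x] br_antisym[of "br z x" y] by simp
  also have "\<dots> = - (br z (br x y) + br x (br y z) + br y (br z x))"
    by simp
  finally show ?thesis using jacobi[of z x y] by simp
qed

lemma br_left_in_subspace:
  assumes "subspace W" "x \<in> span S" "\<And>s. s \<in> S \<Longrightarrow> br s y \<in> W"
  shows "br x y \<in> W"
  using assms(2)
proof (induction rule: span_induct)
  case base
  show ?case using assms(1) unfolding subspace_def by (simp add: br_left)
qed (use assms in auto)

lemma br_right_in_subspace:
  assumes "subspace W" "y \<in> span S" "\<And>s. s \<in> S \<Longrightarrow> br x s \<in> W"
  shows "br x y \<in> W"
proof -
  have "br y x \<in> W"
  proof (rule br_left_in_subspace[OF assms(1,2)])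
    fix s assume "s \<in> S"
    then have "- br x s \<in> W" using assms by (simp add: subspace_neg)
    then show "br s x \<in> W" using br_antisym[of s x] by simp
  qed
  then have "- br y x \<in> W" using assms by (simp add: subspace_neg)
  then show ?thesis using br_antisym[of x y] by simp
qed

lemma subspace_lower_central: "subspace (lower_central br m)"
  by (induction br m rule: lower_central.induct) auto

lemma br_in_lower_central:
  assumes "1 \<le> m" "y \<in> lower_central br m"
  shows "br x y \<in> lower_central br (Suc m)"
proof -
  obtain k where "m = Suc k" using assms(1) by (cases m) auto
  then show ?thesis using assms(2) by (auto intro: span_base)
qed

lemma lower_central_Suc_subset: "lower_central br (Suc m) \<subseteq> lower_central br m"
proof (induction m)
  case (Suc m)
  show ?case
  proof (cases m)
    case (Suc k)
    then show ?thesis using Suc.IH by (auto intro!: span_mono)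
  qed simp
qed simp

lemma lower_central_antimono: "p \<le> q \<Longrightarrow> lower_central br q \<subseteq> lower_central br p"
  by (rule lift_Suc_antimono_le[of "lower_central br", OF lower_central_Suc_subset])

lemma br_lower_central:
  assumes "1 \<le> i" "1 \<le> j" "x \<in> lower_central br i" "y \<in> lower_central br j"
  shows "br x y \<in> lower_central br (i + j)"
  using assms
proof (induction i arbitrary: j x y rule: dec_induct)
  case base
  then show ?case using br_in_lower_central[of j y x] by simp
next
  case (step i)
  obtain k where k: "i = Suc k" using step.hyps by (cases i) auto
  have "x \<in> span {br a b | a b. b \<in> lower_central br i}" using step.prems k by simp
  then show ?case
  proof (rule br_left_in_subspace[OF subspace_lower_central])
    fix s assume "s \<in> {br a b | a b. b \<in> lower_central br i}"
    then obtain a b where s: "s = br a b" and b: "b \<in> lower_central br i" by blast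
    have "br a (br b y) \<in> lower_central br (Suc (i + j))"
      using step b by (intro br_in_lower_central) auto
    moreover have "br b (br a y) \<in> lower_central br (i + Suc j)"
      using step b by (intro step.IH br_in_lower_central) auto
    ultimately have "br a (br b y) - br b (br a y) \<in> lower_central br (Suc i + j)"
      by (intro subspace_diff[OF subspace_lower_central]) auto
    then show "br s y \<in> lower_central br (Suc i + j)"
      unfolding s br_derivation[of a b y] by simp
  qed
qed

text \<open>Each term of the lower central series depends on the previous one only, so a repetition is
permanent. This is what makes the series of a filiform algebra strictly decreasing.\<close>

lemma lower_central_stationary:
  assumes "1 \<le> m" "lower_central br (Suc m) = lower_central br m" "m \<le> q"
  shows "lower_central br q = lower_central br m"
  using assms(3)
proof (induction q rule: dec_induct)
  case (step q)
  obtain k where k: "m = Suc k" using assms(1) by (cases m) auto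
  obtain l where l: "q = Suc l" using assms(1) step by (cases q) auto
  show ?case using step.IH assms(2) unfolding l k by simp
qed simp

end

text \<open>The terms are now used through the lemmas above only; unfolding \<open>C (Suc (Suc m))\<close> to a span
would hide them from the simplifier.\<close>

declare lower_central.simps(3) [simp del]

locale filiform_lie_algebra = lie_algebra br
  for br :: "'a::real_vector \<Rightarrow> 'a \<Rightarrow> 'a" +
  fixes n :: nat
  assumes filiform: "filiform br" and dimension: "dim (UNIV :: 'a set) = n" and n_ge: "5 \<le> n"
begin

abbreviation C where "C \<equiv> lower_central br"

lemma lower_central_end: "n \<le> m \<Longrightarrow> C m = {0}"
  using filiform lower_central_antimono[of n m] subspace_0[OF subspace_lower_central, of m]
  unfolding filiform_def dimension by auto

lemma lower_central_strict:
  assumes "1 \<le> m" "m < n"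
  shows "\<exists>x. x \<in> C m \<and> x \<notin> C (Suc m)"
proof (rule ccontr)
  assume "\<not> ?thesis"
  then have eq: "C (Suc m) = C m" using lower_central_Suc_subset[of m] by blast
  have "C (n - 1) = C m" "C n = C m"
    by (rule lower_central_stationary[OF assms(1) eq], use assms in simp)+
  then show False using filiform unfolding filiform_def dimension by simp
qed

text \<open>Below the second term each step of the series drops by at least one dimension, and nilpotency of
maximal length leaves \<open>n - 2\<close> such steps. The two missing steps are supplied by \<open>x\<close> and \<open>y\<close>: they
are independent modulo \<open>C 2\<close>, because a relation between them modulo \<open>C 2\<close> would put \<open>[x, y]\<close>
into \<open>C 3\<close>.\<close>

lemma lower_central_flag:
  assumes gen: "br x y \<notin> C 3" and u: "u 1 = x" "u 2 = y"
    and um: "\<And>m. 3 \<le> m \<Longrightarrow> m \<le> n \<Longrightarrow> u m \<in> C (m - 1)" "\<And>m. 3 \<le> m \<Longrightarrow> m \<le> n \<Longrightarrow> u m \<notin> C m"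
  shows "is_basis n u" and "\<And>m. 3 \<le> m \<Longrightarrow> C (m - 1) = span (u ` {m..n})"
proof -
  define F where "F m = (if m \<le> 1 then UNIV else if m = 2 then span (insert y (C 2)) else C (m - 1))" for m
  obtain B :: "'a set" where B: "finite B" "span B = UNIV"
    using filiform unfolding filiform_def by blast
  have spanC: "span (C m) = C m" for m
    using subspace_lower_central by (simp add: span_eq_iff)
  have C3: "br c z \<in> C 3" if "c \<in> C 2" for c z
    using br_lower_central[of 2 1 c z] that by simp
  have y: "y \<notin> C 2" using gen br_in_lower_central[of 2 y x] by (auto simp: numeral_3_eq_3)
  have x: "x \<notin> span (insert y (C 2))"
  proof
    assume "x \<in> span (insert y (C 2))"
    then obtain a where "x - a *\<^sub>R y \<in> C 2" unfolding span_breakdown_eq spanC by blast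
    then have "br (x - a *\<^sub>R y) y \<in> C 3" by (rule C3)
    then show False using gen by (simp add: br_left alternating)
  qed
  have sub: "subspace (F m)" for m unfolding F_def using subspace_lower_central by simp
  have dec: "F (Suc m) \<subseteq> F m" for m
  proof -
    consider "m \<le> 1" | "m = 2" | "3 \<le> m" by linarith
    then show ?thesis
    proof cases
      case 2
      then show ?thesis unfolding F_def by (auto intro: span_base)
    next
      case 3
      then show ?thesis unfolding F_def using lower_central_antimono[of "m - 1" m] by auto
    qed (simp add: F_def)
  qed
  have last: "F (Suc n) = {0}" unfolding F_def using n_ge lower_central_end by simp
  have uF: "u m \<in> F m \<and> u m \<notin> F (Suc m)" if m: "1 \<le> m" "m \<le> n" for m
  proof -
    consider "m = 1" | "m = 2" | "3 \<le> m" using m by linarith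
    then show ?thesis
    proof cases
      case 1
      then show ?thesis using u x unfolding F_def by (simp add: numeral_2_eq_2)
    next
      case 2
      then show ?thesis using u y unfolding F_def by (simp add: span_base)
    next
      case 3
      then show ?thesis using um m unfolding F_def by simp
    qed
  qed
  note flag = flag_basis[OF B dimension sub dec last, of u]
  show "is_basis n u" using flag(1) uF by blast
  fix m :: nat assume m: "3 \<le> m"
  show "C (m - 1) = span (u ` {m..n})"
  proof (cases "m \<le> Suc n")
    case True
    then have "F m = span (u ` {m..n})" using flag(2)[of m] uF m by simp
    then show ?thesis using m unfolding F_def by simp
  next
    case False
    then show ?thesis using lower_central_end[of "m - 1"] by simp
  qed
qed

text \<open>Complete \<open>v\<close> to an adapted basis: \<open>C m\<close> is spanned by \<open>v\<close> and by those later vectors of it that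
span the next term.\<close>

lemma lower_central_quotient_line:
  assumes gen: "br x y \<notin> C 3" and m: "2 \<le> m" "m < n"
    and v: "v \<in> C m" "v \<notin> C (Suc m)" and z: "z \<in> C m"
  shows "\<exists>a. z - a *\<^sub>R v \<in> C (Suc m)"
proof -
  have "\<exists>w. w \<in> C (j - 1) \<and> w \<notin> C j" if "3 \<le> j" "j \<le> n" for j
    using lower_central_strict[of "j - 1"] that by simp
  then obtain w where w: "w j \<in> C (j - 1)" "w j \<notin> C j" if "3 \<le> j" "j \<le> n" for j
    by metis
  define u where "u j = (if j = 1 then x else if j = 2 then y else if j = Suc m then v else w j)" for j
  have "u j \<in> C (j - 1) \<and> u j \<notin> C j" if "3 \<le> j" "j \<le> n" for j
    using that v w unfolding u_def by auto
  then have *: "C (j - 1) = span (u ` {j..n})" if "3 \<le> j" for j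
    using lower_central_flag(2)[OF gen, of u j] that unfolding u_def by simp
  have "{Suc m..n} = insert (Suc m) {Suc (Suc m)..n}" using m by auto
  then have "z \<in> span (insert (u (Suc m)) (u ` {Suc (Suc m)..n}))"
    using *[of "Suc m"] z m by simp
  moreover have "u (Suc m) = v" unfolding u_def using m by simp
  ultimately show ?thesis
    unfolding span_breakdown_eq using *[of "Suc (Suc m)"] m by simp
qed

text \<open>For each \<open>m\<close> the elements \<open>x\<close> whose bracket maps \<open>C m\<close> into \<open>C (m + 2)\<close> form a proper subspace,
since otherwise \<open>C (m + 1) = C (m + 2)\<close>. Any \<open>x\<close> outside all of these serves as \<open>e\<^sub>1\<close>: since the
quotients are lines, \<open>ad x\<close> carries a generator of one quotient to a generator of the next, so the
iterated brackets with \<open>x\<close> of a second generator form an adapted basis. That generator is only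
determined modulo \<open>x\<close>, and the freedom is used to achieve the last condition.\<close>

theorem adapted_basis_exists:
  obtains e where "is_basis n e" "\<And>i. 2 \<le> i \<Longrightarrow> br (e 1) (e i) = e (Suc i)"
    "\<And>i. n < i \<Longrightarrow> e i = 0"
    "\<And>i j. 2 \<le> i \<Longrightarrow> 2 \<le> j \<Longrightarrow> br (e i) (e j) \<in> span (e ` {i + j - 1..n})"
    "br (e 2) (e 3) \<in> span (e ` {5..n})"
proof -
  define X where "X m = {x. \<forall>y\<in>C m. br x y \<in> C (m + 2)}" for m
  have "\<exists>x. \<forall>m\<in>{1..n - 2}. x \<notin> X m"
  proof (rule avoid_finitely_many_proper_subspaces)
    fix m assume m: "m \<in> {1..n - 2}"
    show "subspace (X m)"
      using subspace_lower_central[of "m + 2"] unfolding subspace_def X_def by (simp add: br_left)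
    show "X m \<noteq> UNIV"
    proof
      assume X: "X m = UNIV"
      obtain k where k: "m = Suc k" using m by (cases m) auto
      have "span {br x y | x y. y \<in> C m} \<subseteq> C (Suc (Suc m))"
        using X unfolding X_def by (intro span_minimal subspace_lower_central) auto
      then have "C (Suc m) \<subseteq> C (Suc (Suc m))"
        using lower_central.simps(3)[of br k] k by simp
      moreover have "Suc m < n" using m n_ge by auto
      ultimately show False using lower_central_strict[of "Suc m"] by auto
    qed
  qed simp
  then obtain x where x: "\<And>m. 1 \<le> m \<Longrightarrow> m \<le> n - 2 \<Longrightarrow> \<exists>y\<in>C m. br x y \<notin> C (Suc (Suc m))"
    unfolding X_def by fastforce
  have "1 \<le> n - 2" using n_ge by simp
  then obtain y where y: "br x y \<notin> C 3"
    using x[of 1] by (auto simp: numeral_3_eq_3)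
  have raise: "br x v \<notin> C (Suc (Suc m))" if m: "2 \<le> m" "m \<le> n - 2" and v: "v \<in> C m" "v \<notin> C (Suc m)" for m v
  proof
    assume bad: "br x v \<in> C (Suc (Suc m))"
    obtain z where z: "z \<in> C m" "br x z \<notin> C (Suc (Suc m))" using x[of m] m by auto
    have "m < n" using m n_ge by linarith
    then obtain a where a: "z - a *\<^sub>R v \<in> C (Suc m)"
      using lower_central_quotient_line[OF y, of m v z] m v z by auto
    then have "br x (z - a *\<^sub>R v) \<in> C (Suc (Suc m))" by (intro br_in_lower_central) auto
    then have "br x (z - a *\<^sub>R v) + a *\<^sub>R br x v \<in> C (Suc (Suc m))"
      using bad by (intro subspace_add subspace_scale subspace_lower_central)
    then show False using z(2) by (simp add: br_right)
  qed
  define z where "z = br x y"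
  have z: "z \<in> C 2" "z \<notin> C 3"
    using br_in_lower_central[of 1 y x] y unfolding z_def by (simp_all add: numeral_2_eq_2)
  have "2 \<le> n - 2" using n_ge by simp
  then have xz: "br x z \<in> C 3" "br x z \<notin> C 4" "br y z \<in> C 3"
    using br_in_lower_central[of 2 z] z raise[of 2 z] by (simp_all add: eval_nat_numeral)
  \<comment> \<open>Both brackets lie in the line \<open>C 3\<close> modulo \<open>C 4\<close>; subtracting \<open>s\<close> times \<open>x\<close> from \<open>y\<close> makes the first one zero there.\<close>
  obtain s where s: "br y z - s *\<^sub>R br x z \<in> C 4"
    using lower_central_quotient_line[OF y, of 3 "br x z" "br y z"] xz n_ge by auto
  define y' where "y' = y - s *\<^sub>R x"
  have xy': "br x y' = z" unfolding y'_def z_def by (simp add: br_right alternating)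
  define e where "e i = (if i = 1 then x else (br x ^^ (i - 2)) y')" for i
  have e1: "e 1 = x" and e2: "e 2 = y'" unfolding e_def by simp_all
  have eS: "br (e 1) (e i) = e (Suc i)" if i: "2 \<le> i" for i
  proof -
    obtain k where "i = 2 + k" using i le_Suc_ex by blast
    then show ?thesis unfolding e_def by simp
  qed
  have e3: "e 3 = z" using eS[of 2] xy' e1 e2 by (simp add: eval_nat_numeral)
  have eC: "e i \<in> C (i - 1) \<and> (i \<le> n \<longrightarrow> e i \<notin> C i)" if "3 \<le> i" for i
    using that
  proof (induction i rule: dec_induct)
    case base
    then show ?case using e3 z by simp
  next
    case (step i)
    have "e (Suc i) \<in> C i"
      using br_in_lower_central[of "i - 1" "e i" x] step eS[of i] e1 by simp
    moreover have "e (Suc i) \<notin> C (Suc i)" if "Suc i \<le> n"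
    proof -
      have "br x (e i) \<notin> C (Suc (Suc (i - 1)))"
        by (rule raise) (use step that in auto)
      then show ?thesis using eS[of i] e1 step by simp
    qed
    ultimately show ?case by simp
  qed
  have gen: "br x y' \<notin> C 3" using xy' z by simp
  have mem: "e m \<in> C (m - 1)" "e m \<notin> C m" if "3 \<le> m" "m \<le> n" for m
    using eC[OF that(1)] that(2) by blast+
  note flag = lower_central_flag[OF gen e1 e2 mem]
  have e0: "e i = 0" if "n < i" for i
    using eC[of i] lower_central_end[of "i - 1"] that n_ge by simp
  have brC: "br (e i) (e j) \<in> span (e ` {i + j - 1..n})" if ij: "2 \<le> i" "2 \<le> j" for i j
  proof -
    have *: "e i \<in> C (i - 1)" if "2 \<le> i" for i
      using eC[of i] that by (cases "i = 2") auto
    have "br (e i) (e j) \<in> C ((i - 1) + (j - 1))"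
      using ij * by (intro br_lower_central) auto
    moreover have "(i - 1) + (j - 1) = i + j - 1 - 1" using ij by simp
    ultimately show ?thesis using flag(2)[of "i + j - 1"] ij by simp
  qed
  have "br (e 2) (e 3) = br y z - s *\<^sub>R br x z"
    unfolding e2 e3 y'_def by (simp add: br_left)
  then have "br (e 2) (e 3) \<in> span (e ` {5..n})"
    using s flag(2)[of 5] by simp
  then show ?thesis using that flag(1) eS e0 brC by blast
qed

end

section \<open>Structure constants of the associated graded algebra\<close>

lemma span_image_interval_sum:
  fixes f :: "nat \<Rightarrow> 'a::real_vector"
  assumes inj: "inj_on f {m..n}" and x: "x \<in> span (f ` {Suc p..n})" and mp: "m \<le> Suc p"
  shows "\<exists>a. x = (\<Sum>l = 1..n - p. a l *\<^sub>R f (p + l))"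
proof -
  have inj': "inj_on f {Suc p..n}" by (rule inj_on_subset[OF inj]) (use mp in auto)
  obtain u where "x = (\<Sum>v\<in>f ` {Suc p..n}. u v *\<^sub>R v)"
    using x by (auto simp: span_finite)
  also have "\<dots> = (\<Sum>i = Suc p..n. u (f i) *\<^sub>R f i)"
    by (simp add: sum.reindex[OF inj'])
  also have "\<dots> = (\<Sum>l = 1..n - p. u (f (p + l)) *\<^sub>R f (p + l))"
    by (rule sum.reindex_bij_witness[of _ "\<lambda>l. p + l" "\<lambda>i. i - p"]) auto
  finally show ?thesis by (intro exI)
qed

text \<open>A basis adapted to a descending filtration by index. With \<open>s = 1\<close> this is the filtration by the
lower central series, where \<open>e\<^sub>1\<close> and \<open>e\<^sub>2\<close> both have degree one and \<open>e\<^sub>i\<close> has degree \<open>i - 1\<close> for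
\<open>i \<ge> 2\<close>; with \<open>s = 0\<close> the element \<open>e\<^sub>i\<close> has degree \<open>i\<close>. Both cases occur in the proof, in this
order, and share the passage to the associated graded algebra. The convention \<open>e\<^sub>i = 0\<close> for
\<open>i > n\<close> lets brackets that leave the index range be treated uniformly.\<close>

locale graded_basis = lie_algebra br
  for br :: "'a::real_vector \<Rightarrow> 'a \<Rightarrow> 'a" +
  fixes n :: nat and e :: "nat \<Rightarrow> 'a" and s :: nat
  assumes basis: "is_basis n e"
    and ad_e1: "2 \<le> i \<Longrightarrow> br (e 1) (e i) = e (Suc i)"
    and beyond: "n < i \<Longrightarrow> e i = 0"
    and filtered: "2 \<le> i \<Longrightarrow> 2 \<le> j \<Longrightarrow> br (e i) (e j) \<in> span (e ` {i + j - s..n})"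
    and shift: "s \<le> 1"
begin

definition T :: "nat \<Rightarrow> 'a set" where
  "T m = span (e ` {m..n})"

definition coord :: "nat \<Rightarrow> 'a \<Rightarrow> real" where
  "coord m v = representation (e ` {1..n}) v (e m)"

text \<open>The structure constants of the associated graded algebra: the coefficient of the leading term of
\<open>[e\<^sub>i, e\<^sub>j]\<close>.\<close>

definition sc :: "nat \<Rightarrow> nat \<Rightarrow> real" where
  "sc i j = coord (i + j - s) (br (e i) (e j))"

lemma subspace_T: "subspace (T m)"
  unfolding T_def by simp

lemma T_antimono: "p \<le> q \<Longrightarrow> T q \<subseteq> T p"
  unfolding T_def by (rule span_mono) auto

lemma T_beyond: "n < m \<Longrightarrow> T m = {0}"
  unfolding T_def by simp

lemma T_1: "T 1 = UNIV"
  using basis unfolding T_def is_basis_def by simp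

lemma e_in_T: "m \<le> i \<Longrightarrow> e i \<in> T m"
  by (cases "i \<le> n") (auto simp: T_def beyond intro: span_base span_zero)

lemma independent_basis: "independent (e ` {1..n})"
  using basis unfolding is_basis_def by simp

lemma in_span_basis: "v \<in> span (e ` {1..n})"
  using basis unfolding is_basis_def by simp

lemma coord_add: "coord m (x + y) = coord m x + coord m y"
  unfolding coord_def by (simp add: representation_add[OF independent_basis in_span_basis in_span_basis] del: One_nat_def)

lemma coord_diff: "coord m (x - y) = coord m x - coord m y"
  unfolding coord_def by (simp add: representation_diff[OF independent_basis in_span_basis in_span_basis] del: One_nat_def)

lemma coord_neg: "coord m (- x) = - coord m x"
  unfolding coord_def by (simp add: representation_neg[OF independent_basis in_span_basis] del: One_nat_def)

lemma coord_scale: "coord m (a *\<^sub>R x) = a * coord m x"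
  unfolding coord_def by (simp add: representation_scale[OF independent_basis in_span_basis] del: One_nat_def)

lemma coord_zero: "coord m 0 = 0"
  unfolding coord_def by (simp add: representation_zero)

lemma coord_e:
  assumes "1 \<le> i" "i \<le> n" "1 \<le> m" "m \<le> n"
  shows "coord m (e i) = (if i = m then 1 else 0)"
proof -
  have "e i = e m \<longleftrightarrow> i = m"
    using basis assms unfolding is_basis_def by (auto dest: inj_onD)
  then show ?thesis
    unfolding coord_def using representation_basis[OF independent_basis, of "e i"] assms by auto
qed

lemma coord_T:
  assumes "1 \<le> m" "m \<le> n" "x \<in> T (Suc m)"
  shows "coord m x = 0"
  using assms(3) unfolding T_def
proof (induction rule: span_induct)
  case base
  show ?case by (simp add: subspace_def coord_add coord_scale coord_zero)
next
  case (step x)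
  then show ?case using coord_e assms by auto
qed

lemma T_split:
  assumes "1 \<le> m" "x \<in> T m"
  shows "x - coord m x *\<^sub>R e m \<in> T (Suc m)"
proof (cases "m \<le> n")
  case True
  then have "{m..n} = insert m {Suc m..n}" by auto
  then have "x \<in> span (insert (e m) (e ` {Suc m..n}))"
    using assms(2) unfolding T_def by simp
  then obtain a where a: "x - a *\<^sub>R e m \<in> T (Suc m)"
    unfolding span_breakdown_eq T_def by blast
  then have "coord m (x - a *\<^sub>R e m) = 0"
    using coord_T assms True by simp
  then have "coord m x = a"
    using coord_e[of m m] assms True by (simp add: coord_diff coord_scale)
  then show ?thesis using a by simp
next
  case False
  then have "x = 0" using assms T_beyond[of m] by auto
  then show ?thesis using subspace_0[OF subspace_T] by (simp add: coord_zero)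
qed

lemma br_T:
  assumes "2 \<le> p" "2 \<le> q" "x \<in> T p" "y \<in> T q"
  shows "br x y \<in> T (p + q - s)"
proof -
  have "br (e i) y \<in> T (p + q - s)" if i: "p \<le> i" for i
  proof -
    have "y \<in> span (e ` {q..n})" using assms unfolding T_def by simp
    then show ?thesis
    proof (rule br_right_in_subspace[OF subspace_T])
      fix z assume "z \<in> e ` {q..n}"
      then obtain j where j: "z = e j" "q \<le> j" by auto
      then have "p + q - s \<le> i + j - s" using i by linarith
      then show "br (e i) z \<in> T (p + q - s)"
        using filtered[of i j] T_antimono[of "p + q - s" "i + j - s"] assms i j
        unfolding T_def[symmetric] by auto
    qed
  qed
  moreover have "x \<in> span (e ` {p..n})" using assms unfolding T_def by simp
  ultimately show ?thesis
    by (auto intro: br_left_in_subspace[OF subspace_T])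
qed

lemma ad_e1_T:
  assumes "2 \<le> q" "y \<in> T q"
  shows "br (e 1) y \<in> T (Suc q)"
proof -
  have "y \<in> span (e ` {q..n})" using assms unfolding T_def by simp
  then show ?thesis
    by (rule br_right_in_subspace[OF subspace_T]) (use assms ad_e1 e_in_T in auto)
qed

lemma br_e_T: "2 \<le> i \<Longrightarrow> 2 \<le> j \<Longrightarrow> br (e i) (e j) \<in> T (i + j - s)"
  using filtered unfolding T_def .

lemma br_e_split:
  assumes "2 \<le> i" "2 \<le> j"
  shows "br (e i) (e j) - sc i j *\<^sub>R e (i + j - s) \<in> T (Suc (i + j - s))"
  unfolding sc_def using T_split[OF _ br_e_T[OF assms]] assms shift by simp

lemma sc_antisym: "sc i j = - sc j i"
  unfolding sc_def using br_antisym[of "e i" "e j"] by (simp add: coord_neg add.commute)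

text \<open>The coefficient of \<open>e\<^bsub>i+j+1-s\<^esub>\<close> in the Leibniz rule for \<open>ad e\<^sub>1\<close>, where \<open>ad e\<^sub>1\<close> shifts leading
terms without changing their coefficients.\<close>

lemma derivation_recurrence_sc: "derivation_recurrence (n + s) sc"
  unfolding derivation_recurrence_def
proof (intro conjI allI impI)
  fix i j :: nat assume ij: "2 \<le> i" "2 \<le> j" "i + j < n + s"
  define q where "q = i + j - s"
  have q: "2 \<le> q" "Suc q \<le> n" "Suc (i + j) - s = Suc q" using ij shift unfolding q_def by auto
  define r where "r = br (e i) (e j) - sc i j *\<^sub>R e q"
  have "r \<in> T (Suc q)" using br_e_split[OF ij(1,2)] unfolding r_def q_def .
  then have "coord (Suc q) (br (e 1) r) = 0"
    using ad_e1_T[of "Suc q" r] coord_T[of "Suc q"] q by simp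
  moreover have "br (e (Suc i)) (e j) + br (e i) (e (Suc j)) = br (e 1) (br (e i) (e j))"
    using br_derivation[of "e 1" "e i" "e j"] ad_e1 ij by simp
  moreover have "br (e 1) (br (e i) (e j)) = br (e 1) r + sc i j *\<^sub>R e (Suc q)"
    using ad_e1 q unfolding r_def by (simp add: br_right)
  ultimately have "coord (Suc q) (br (e (Suc i)) (e j) + br (e i) (e (Suc j))) = sc i j"
    using coord_e[of "Suc q" "Suc q"] q by (simp add: coord_add coord_scale)
  then show "sc (Suc i) j + sc i (Suc j) = sc i j"
    using q(3) unfolding sc_def by (simp add: coord_add)
qed (rule sc_antisym)

lemma coord_double_bracket:
  assumes "2 \<le> i" "2 \<le> j" "2 \<le> l" "i + j + l \<le> n + 2 * s"
  shows "coord (i + j + l - 2 * s) (br (br (e i) (e j)) (e l)) = sc i j * sc (i + j - s) l"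
proof -
  define q where "q = i + j - s"
  have q: "2 \<le> q" "q + l - s = i + j + l - 2 * s" "1 \<le> q + l - s" "q + l - s \<le> n"
    "Suc q + l - s = Suc (q + l - s)"
    using assms shift unfolding q_def by auto
  define r where "r = br (e i) (e j) - sc i j *\<^sub>R e q"
  have "r \<in> T (Suc q)" using br_e_split[OF assms(1,2)] unfolding r_def q_def .
  then have "br r (e l) \<in> T (Suc (q + l - s))"
    using br_T[of "Suc q" l r "e l"] e_in_T[of l l] assms q by simp
  then have "coord (q + l - s) (br r (e l)) = 0"
    using coord_T q by simp
  moreover have "br (br (e i) (e j)) (e l) = br r (e l) + sc i j *\<^sub>R br (e q) (e l)"
    unfolding r_def by (simp add: br_left)
  ultimately show ?thesis
    unfolding q(2)[symmetric] by (simp add: coord_add coord_scale sc_def[of q l] q_def[symmetric])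
qed

lemma jacobi_sc:
  assumes "2 \<le> i" "2 \<le> j" "2 \<le> l" "i + j + l \<le> n + 2 * s"
  shows "sc i j * sc (i + j - s) l + sc j l * sc (j + l - s) i + sc l i * sc (l + i - s) j = 0"
proof -
  define p where "p = i + j + l - 2 * s"
  have "br (br (e i) (e j)) (e l) + br (br (e j) (e l)) (e i) + br (br (e l) (e i)) (e j) = 0"
    by (rule jacobi_left)
  then have "coord p (br (br (e i) (e j)) (e l) + br (br (e j) (e l)) (e i) + br (br (e l) (e i)) (e j)) = 0"
    by (simp add: coord_zero)
  moreover have "j + l + i - 2 * s = p" "l + i + j - 2 * s = p" unfolding p_def by simp_all
  ultimately show ?thesis
    using coord_double_bracket[of i j l] coord_double_bracket[of j l i] coord_double_bracket[of l i j] assms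
    unfolding p_def by (simp add: coord_add)
qed

end

section \<open>The symplectic form in an adapted basis\<close>

locale symplectic_graded_basis = graded_basis br n e s
  for br :: "'a::real_vector \<Rightarrow> 'a \<Rightarrow> 'a" and n e s +
  fixes \<omega> :: "'a \<Rightarrow> 'a \<Rightarrow> real"
  assumes symplectic: "symplectic_form br \<omega>" and even_n: "even n" and n_ge: "6 \<le> n"
begin

lemma bilinear_\<omega>: "bilinear \<omega>"
  using symplectic unfolding symplectic_form_def by blast

lemmas \<omega>_left = bilinear_ladd[OF bilinear_\<omega>] bilinear_lsub[OF bilinear_\<omega>]
  bilinear_lmul[OF bilinear_\<omega>] bilinear_lneg[OF bilinear_\<omega>] bilinear_lzero[OF bilinear_\<omega>]

lemmas \<omega>_right = bilinear_radd[OF bilinear_\<omega>] bilinear_rsub[OF bilinear_\<omega>]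
  bilinear_rmul[OF bilinear_\<omega>] bilinear_rneg[OF bilinear_\<omega>] bilinear_rzero[OF bilinear_\<omega>]

lemma \<omega>_antisym: "\<omega> x y = - \<omega> y x"
  using symplectic unfolding symplectic_form_def by blast

lemma \<omega>_closed: "\<omega> (br x y) z + \<omega> (br y z) x + \<omega> (br z x) y = 0"
  using symplectic unfolding symplectic_form_def by blast

lemma \<omega>_left_vanishes:
  assumes "x \<in> T m" "\<And>i. m \<le> i \<Longrightarrow> i \<le> n \<Longrightarrow> \<omega> (e i) y = 0"
  shows "\<omega> x y = 0"
  using assms(1) unfolding T_def
proof (induction rule: span_induct)
  case base
  show ?case by (simp add: subspace_def \<omega>_left)
qed (use assms(2) in auto)

lemma \<omega>_nondegenerate:
  assumes "\<And>i. 1 \<le> i \<Longrightarrow> i \<le> n \<Longrightarrow> \<omega> x (e i) = 0"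
  shows "x = 0"
proof -
  have "\<omega> y x = 0" for y
    by (rule \<omega>_left_vanishes[of _ 1]) (use T_1 assms \<omega>_antisym[of _ x] in auto)
  then have "\<omega> x y = 0" for y using \<omega>_antisym[of x y] by simp
  then show ?thesis using symplectic unfolding symplectic_form_def by blast
qed

lemma e_nonzero: "1 \<le> i \<Longrightarrow> i \<le> n \<Longrightarrow> e i \<noteq> 0"
  using coord_e[of i i] coord_zero[of i] by auto

text \<open>Closedness for \<open>e\<^sub>1, e\<^sub>i, e\<^sub>j\<close>. The form satisfies the same recurrence as the structure constants,
one weight above the bracket on the right; this is how the form is used to extend the structure
constants beyond the last weight.\<close>

lemma \<omega>_step:
  assumes "2 \<le> i" "2 \<le> j"
  shows "\<omega> (e (Suc i)) (e j) + \<omega> (e i) (e (Suc j)) = \<omega> (e 1) (br (e i) (e j))"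
proof -
  have "\<omega> (br (e j) (e 1)) (e i) = \<omega> (e i) (e (Suc j))"
    using br_antisym[of "e j" "e 1"] ad_e1[of j] \<omega>_antisym[of "e i"] assms by (simp add: \<omega>_left)
  moreover have "\<omega> (br (e i) (e j)) (e 1) = - \<omega> (e 1) (br (e i) (e j))"
    by (rule \<omega>_antisym)
  ultimately show ?thesis
    using \<omega>_closed[of "e 1" "e i" "e j"] ad_e1[of i] assms by simp
qed

text \<open>Where the bracket of \<open>e\<^sub>i\<close> and \<open>e\<^sub>j\<close> vanishes for reasons of degree, \<open>\<omega>\<close> only changes its sign when
a unit is shifted from one index to the other; shifting until the second index exceeds \<open>n\<close> gives
zero. The shift may not pass below \<open>e\<^sub>2\<close>, whence the bound \<open>n + 3\<close>.\<close>

lemma \<omega>_far: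
  assumes "n + 3 \<le> i + j"
  shows "\<omega> (e i) (e j) = 0"
proof -
  have "\<omega> (e i) (e j) = 0" if "j + d = Suc n" "n + 3 \<le> i + j" for i j d
    using that
  proof (induction d arbitrary: i j)
    case 0
    then show ?case by (simp add: beyond \<omega>_right)
  next
    case (Suc d)
    show ?case
    proof (cases "i \<le> n")
      case True
      then have i: "2 \<le> i - 1" "2 \<le> j" "Suc (i - 1) = i" using Suc.prems by auto
      have "i - 1 + j - s > n" using Suc.prems shift by linarith
      then have "br (e (i - 1)) (e j) = 0" using br_e_T[OF i(1,2)] T_beyond by auto
      then show ?thesis
        using \<omega>_step[OF i(1,2)] i(3) Suc.IH[of "Suc j" "i - 1"] Suc.prems by (simp add: \<omega>_right)
    qed (simp add: beyond \<omega>_left)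
  qed
  from this[of j "Suc n - j" i] show ?thesis
    using assms beyond[of j] by (cases "j \<le> Suc n") (auto simp: \<omega>_right)
qed

end

section \<open>The grading by the lower central series\<close>

locale first_grading = symplectic_graded_basis br n e 1 \<omega>
  for br :: "'a::real_vector \<Rightarrow> 'a \<Rightarrow> 'a" and n e \<omega> +
  assumes br_e2_e3: "br (e 2) (e 3) \<in> span (e ` {5..n})"
begin

lemma sc_2_3: "sc 2 3 = 0"
  using coord_T[of 4 "br (e 2) (e 3)"] br_e2_e3 n_ge unfolding sc_def T_def by simp

text \<open>If the first nonzero weight were \<open>2 * m + 1 \<le> n\<close>, the Jacobi relation for \<open>(m, m + 1, 2)\<close> would
give \<open>sc 2 (2 * m) = 0\<close>, whereas the recurrence makes this entry a nonzero multiple of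
\<open>sc m (m + 1)\<close>.\<close>

lemma sc_vanishes_below_top:
  assumes "2 \<le> i" "2 \<le> j" "i + j \<le> n"
  shows "sc i j = 0"
proof (rule ccontr)
  assume nz: "sc i j \<noteq> 0"
  note rec = derivation_recurrence_sc
  obtain m where m: "2 \<le> m" "2 * m + 1 \<le> n" "sc m (m + 1) \<noteq> 0"
    and van: "\<And>w. w \<le> 2 * m \<Longrightarrow> vanishes_at_weight w sc"
    using first_nonzero_weight[OF rec assms _ nz] by auto
  have "m \<noteq> 2" using m sc_2_3 by auto
  then have m3: "3 \<le> m" using m by simp
  have "sc (m + 1) 2 = 0" "sc 2 m = 0"
    using van[of "m + 3"] van[of "m + 2"] m3 unfolding vanishes_at_weight_def by auto
  then have "sc m (m + 1) * sc (m + (m + 1) - 1) 2 = 0"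
    using jacobi_sc[of m "m + 1" 2] m m3 by simp
  then have "sc (2 * m) 2 = 0" using m by (simp add: mult_2)
  then have "sc 2 (2 * m) = 0" using sc_antisym[of 2 "2 * m"] by simp
  moreover have "m + 2 + (m - 2) = 2 * m" using m by simp
  ultimately have "sc 2 (m + 2 + (m - 2)) = 0" by (simp only:)
  moreover have "sc 2 (m + 2 + (m - 2)) = (-1) ^ (m - 2) * real (m - 2 + 1) * sc m (m + 1)"
    by (rule first_weight_after[OF rec _ van[OF order_refl]]) (use m in auto)
  ultimately show False using m by simp
qed

text \<open>At the last weight \<open>n + 1\<close> the algebra itself leaves one parameter \<open>\<rho>\<close>. The form excludes it: let
\<open>A = \<omega> (e 1) (e n)\<close>. Extending \<open>A * sc\<close> by the values of \<open>\<omega>\<close> at the weight \<open>n + 2\<close>, the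
recurrence gives \<open>\<omega> (e 2) (e n)\<close> as a nonzero multiple of \<open>A * \<rho>\<close>, while closedness for
\<open>(2, 3, n - 2)\<close> gives \<open>\<rho> * \<omega> (e 2) (e n) = 0\<close>. If \<open>\<rho> \<noteq> 0\<close>, then \<open>\<omega> (e 2) (e n)\<close> and \<open>A\<close> vanish,
so that \<open>e n\<close> is orthogonal to everything.\<close>

lemma sc_vanishes:
  assumes "2 \<le> i" "2 \<le> j" "i + j \<le> n + 1"
  shows "sc i j = 0"
proof -
  obtain k where k: "n = 2 * k" using even_n by blast
  have k3: "3 \<le> k" using k n_ge by simp
  define A where "A = \<omega> (e 1) (e n)"
  define f where "f i j = (if i + j \<le> n + 1 then A * sc i j else \<omega> (e i) (e j))" for i j
  have rec: "derivation_recurrence (n + 2) f"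
    unfolding derivation_recurrence_def
  proof (intro conjI allI impI)
    fix i j :: nat
    show "f i j = - f j i"
      using sc_antisym[of i j] \<omega>_antisym[of "e i" "e j"] unfolding f_def by (simp add: add.commute)
  next
    fix i j :: nat assume ij: "2 \<le> i" "2 \<le> j" "i + j < n + 2"
    show "f (Suc i) j + f i (Suc j) = f i j"
    proof (cases "i + j = n + 1")
      case True
      then have "br (e i) (e j) = sc i j *\<^sub>R e n"
        using br_e_split[OF ij(1,2)] T_beyond[of "Suc n"] by simp
      then show ?thesis
        using \<omega>_step[OF ij(1,2)] True unfolding f_def A_def by (simp add: \<omega>_right)
    next
      case False
      then have "sc (Suc i) j + sc i (Suc j) = sc i j"
        using derivation_recurrence_step[OF derivation_recurrence_sc ij(1,2)] ij by simp
      then show ?thesis using False ij unfolding f_def by (simp add: distrib_left[symmetric])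
    qed
  qed
  have van_sc: "vanishes_at_weight (2 * k) sc" and van_f: "vanishes_at_weight (2 * k) f"
    using sc_vanishes_below_top k unfolding vanishes_at_weight_def f_def by auto
  define \<rho> where "\<rho> = sc k (k + 1)"
  have "f 2 (k + 2 + (k - 2)) = (-1) ^ (k - 2) * real (k - 2 + 1) * f k (k + 1)"
    by (rule first_weight_after[OF rec _ van_f]) (use k k3 in auto)
  moreover have "f k (k + 1) = A * \<rho>" unfolding f_def \<rho>_def k by simp
  moreover have "k + 2 + (k - 2) = n" using k k3 by simp
  moreover have "f 2 n = \<omega> (e 2) (e n)" unfolding f_def by simp
  ultimately have w2: "\<omega> (e 2) (e n) = (-1) ^ (k - 2) * real (k - 2 + 1) * (A * \<rho>)" by simp
  have "sc 3 (k + 1 + (k - 3)) = (-1) ^ (k - 3) * \<rho>"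
    unfolding \<rho>_def
    by (rule odd_weight_alternates[OF derivation_recurrence_sc _ van_sc]) (use k k3 in auto)
  moreover have "k + 1 + (k - 3) = n - 2" using k k3 by simp
  ultimately have sc3: "sc 3 (n - 2) = (-1) ^ (k - 3) * \<rho>" by simp
  have "\<omega> (br (e 2) (e 3)) (e (n - 2)) = 0"
    by (rule \<omega>_left_vanishes[of _ 5]) (use br_e2_e3 n_ge in \<open>auto simp: T_def intro: \<omega>_far\<close>)
  moreover have "\<omega> (br (e (n - 2)) (e 2)) (e 3) = 0"
  proof (rule \<omega>_left_vanishes[of _ n])
    have "2 \<le> n - 2" "n - 2 + 2 - 1 = n - 1" "Suc (n - 1) = n" using n_ge by simp_all
    moreover have "sc (n - 2) 2 = 0" using sc_vanishes_below_top n_ge by simp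
    ultimately show "br (e (n - 2)) (e 2) \<in> T n"
      using br_e_split[of "n - 2" 2] by simp
  qed (auto intro: \<omega>_far)
  moreover have "br (e 3) (e (n - 2)) = sc 3 (n - 2) *\<^sub>R e n"
  proof -
    have "2 \<le> n - 2" "3 + (n - 2) - 1 = n" using n_ge by simp_all
    then show ?thesis using br_e_split[of 3 "n - 2"] T_beyond[of "Suc n"] by simp
  qed
  ultimately have "sc 3 (n - 2) * \<omega> (e n) (e 2) = 0"
    using \<omega>_closed[of "e 2" "e 3" "e (n - 2)"] by (simp add: \<omega>_left)
  then have "\<rho> = 0 \<or> \<omega> (e 2) (e n) = 0"
    using sc3 \<omega>_antisym[of "e 2" "e n"] by auto
  moreover have False if "\<rho> \<noteq> 0" "\<omega> (e 2) (e n) = 0"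
  proof -
    have "A = 0" using w2 that k3 by simp
    then have "\<omega> (e n) (e i) = 0" if "1 \<le> i" "i \<le> n" for i
    proof -
      consider "i = 1" | "i = 2" | "3 \<le> i" using \<open>1 \<le> i\<close> by linarith
      then show ?thesis
      proof cases
        case 3
        then show ?thesis by (intro \<omega>_far) simp
      qed (use \<omega>_antisym[of "e n" "e i"] \<open>A = 0\<close> \<open>\<omega> (e 2) (e n) = 0\<close> in \<open>simp_all add: A_def\<close>)
    qed
    then have "e n = 0" by (rule \<omega>_nondegenerate)
    then show False using e_nonzero[of n] n_ge by simp
  qed
  ultimately have "sc k (k + 1) = 0" unfolding \<rho>_def by blast
  then have "vanishes_at_weight (2 * k + 1) sc"
    using odd_weight_vanishes[OF derivation_recurrence_sc _ van_sc] k by simp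
  then show ?thesis
    using sc_vanishes_below_top[OF assms(1,2)] assms k unfolding vanishes_at_weight_def
    by (cases "i + j \<le> n") auto
qed

text \<open>All leading terms have vanished, so brackets of the \<open>e\<^sub>i\<close> with \<open>i \<ge> 2\<close> gain one degree and the
filtration by plain index is compatible with the bracket.\<close>

theorem second_grading_basis: "symplectic_graded_basis br n e 0 \<omega>"
proof unfold_locales
  fix i j :: nat assume ij: "2 \<le> i" "2 \<le> j"
  have "br (e i) (e j) \<in> T (i + j)"
  proof (cases "i + j \<le> n + 1")
    case True
    then show ?thesis using br_e_split[OF ij] sc_vanishes[OF ij] ij by simp
  next
    case False
    then have "br (e i) (e j) = 0" using br_e_T[OF ij] T_beyond by auto
    then show ?thesis using subspace_0[OF subspace_T] by simp
  qed
  then show "br (e i) (e j) \<in> span (e ` {i + j - 0..n})" unfolding T_def by simp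
qed (use basis ad_e1 beyond symplectic even_n n_ge in auto)

end


section \<open>The grading by index and its symplectic extension\<close>

locale second_grading = symplectic_graded_basis br n e 0 \<omega>
  for br :: "'a::real_vector \<Rightarrow> 'a \<Rightarrow> 'a" and n e \<omega>
begin

text \<open>At the even weight \<open>n + 2\<close> the recurrence has no source term, so the form vanishes there as well,
and the higher weights are covered by the bound that holds in both gradings.\<close>

lemma \<omega>_above_antidiagonal:
  assumes ij: "1 \<le> i" "1 \<le> j" "n + 2 \<le> i + j"
  shows "\<omega> (e i) (e j) = 0"
proof -
  obtain k where k: "n = 2 * k" using even_n by blast
  \<comment> \<open>At the weight \<open>n + 1\<close> the recurrence needs \<open>\<omega> (e 1) [e\<^sub>i, e\<^sub>j]\<close>, which is zero, in place of \<open>\<omega> (e i) (e j)\<close>.\<close>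
  define g where "g i j = (if n + 2 \<le> i + j then \<omega> (e i) (e j) else 0)" for i j
  have rec: "derivation_recurrence (n + 2) g"
    unfolding derivation_recurrence_def
  proof (intro conjI allI impI)
    fix i j :: nat
    show "g i j = - g j i"
      using \<omega>_antisym[of "e i" "e j"] unfolding g_def by (simp add: add.commute)
  next
    fix i j :: nat assume ij: "2 \<le> i" "2 \<le> j" "i + j < n + 2"
    show "g (Suc i) j + g i (Suc j) = g i j"
    proof (cases "i + j = n + 1")
      case True
      then have "br (e i) (e j) = 0" using br_e_T[OF ij(1,2)] T_beyond[of "i + j"] by simp
      then show ?thesis using \<omega>_step[OF ij(1,2)] True unfolding g_def by (simp add: \<omega>_right)
    qed (use ij in \<open>simp add: g_def\<close>)
  qed
  have "vanishes_at_weight (2 * (k + 1)) g"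
    by (rule even_weight_vanishes[OF rec]) (use k in \<open>auto simp: vanishes_at_weight_def g_def\<close>)
  then have diag: "\<omega> (e i) (e j) = 0" if "2 \<le> i" "2 \<le> j" "i + j = n + 2" for i j
    using that k unfolding vanishes_at_weight_def g_def by auto
  consider "n < i \<or> n < j" | "i + j = n + 2" "2 \<le> i" "2 \<le> j" | "n + 3 \<le> i + j"
    using ij by linarith
  then show ?thesis
  proof cases
    case 1
    then show ?thesis using beyond by (auto simp: \<omega>_left \<omega>_right)
  qed (use diag \<omega>_far in auto)
qed

text \<open>The matrix of \<open>\<omega>\<close> is triangular with respect to the antidiagonal, so nondegeneracy makes all
entries on it nonzero. In the proof \<open>m\<close> is the last index with a zero entry, and the rows below it,
whose entries are nonzero, are used to eliminate all entries of the row of \<open>e m\<close>; this produces a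
nonzero vector orthogonal to everything.\<close>

lemma \<omega>_antidiagonal_nonzero:
  assumes m: "1 \<le> m" "m \<le> n"
  shows "\<omega> (e m) (e (Suc n - m)) \<noteq> 0"
proof (rule ccontr)
  let ?P = "\<lambda>m. 1 \<le> m \<and> m \<le> n \<and> \<omega> (e m) (e (Suc n - m)) = 0"
  assume "\<not> ?thesis"
  then have "?P m" using m by simp
  then obtain m where m: "?P m" and max: "\<And>q. ?P q \<Longrightarrow> q \<le> m"
    using GreatestI_nat[of ?P m n] Greatest_le_nat[of ?P _ n] by blast
  have "q \<le> n - m \<Longrightarrow> \<exists>x. x - e m \<in> T (Suc m) \<and> (\<forall>l. q < l \<and> l \<le> n \<longrightarrow> \<omega> x (e l) = 0)" for q
  proof (induction q rule: inc_induct)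
    case base
    have "\<omega> (e m) (e l) = 0" if l: "n - m < l" "l \<le> n" for l
    proof (cases "l = Suc n - m")
      case False
      then show ?thesis using l m by (intro \<omega>_above_antidiagonal) auto
    qed (use m in simp)
    then show ?case using subspace_0[OF subspace_T] by (intro exI[of _ "e m"]) simp
  next
    case (step q)
    then obtain x where x: "x - e m \<in> T (Suc m)" "\<And>l. Suc q < l \<Longrightarrow> l \<le> n \<Longrightarrow> \<omega> x (e l) = 0"
      by auto
    define p where "p = n - q"
    have p: "Suc m \<le> p" "p \<le> n" "Suc n - p = Suc q" using step m unfolding p_def by auto
    have nz: "\<omega> (e p) (e (Suc q)) \<noteq> 0" using max[of p] p by auto
    define t where "t = \<omega> x (e (Suc q)) / \<omega> (e p) (e (Suc q))"
    have "x - e m - t *\<^sub>R e p \<in> T (Suc m)"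
      using p by (intro subspace_diff[OF subspace_T x(1)] subspace_scale[OF subspace_T] e_in_T)
    then have "x - t *\<^sub>R e p - e m \<in> T (Suc m)" by (simp add: algebra_simps)
    moreover have "\<omega> (x - t *\<^sub>R e p) (e l) = 0" if l: "q < l" "l \<le> n" for l
    proof (cases "l = Suc q")
      case True
      then show ?thesis using nz unfolding t_def by (simp add: \<omega>_left)
    next
      case False
      then have "\<omega> (e p) (e l) = 0" using l p by (intro \<omega>_above_antidiagonal) auto
      then show ?thesis using x(2)[of l] l False by (simp add: \<omega>_left)
    qed
    ultimately show ?case by blast
  qed
  from this[of 0] obtain x where x: "x - e m \<in> T (Suc m)" "\<And>l. 1 \<le> l \<Longrightarrow> l \<le> n \<Longrightarrow> \<omega> x (e l) = 0"
    by (auto simp: Suc_le_eq)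
  have "x = 0" using x(2) by (rule \<omega>_nondegenerate)
  then have "coord m (0 - e m) = 0" using coord_T[of m "0 - e m"] x(1) m by simp
  then show False using coord_e[of m m] m by (simp add: coord_neg)
qed

text \<open>By closedness, \<open>\<omega>\<close> restricted to its leading weight \<open>n + 1\<close> is a cocycle of the graded algebra, and
so defines a central extension of it by one element of degree \<open>n + 1\<close>. These are the structure
constants of that extension; the normalization makes \<open>[e\<^sub>1, e\<^sub>n]\<close> the new basis vector.\<close>

definition extended_sc :: "nat \<Rightarrow> nat \<Rightarrow> real" where
  "extended_sc i j = (if i + j \<le> n then sc i j else \<omega> (e i) (e j) / \<omega> (e 1) (e n))"

lemma \<omega>_1_n: "\<omega> (e 1) (e n) \<noteq> 0"
  using \<omega>_antidiagonal_nonzero[of 1] n_ge by simp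

lemma derivation_recurrence_extended_sc: "derivation_recurrence (n + 1) extended_sc"
  unfolding derivation_recurrence_def
proof (intro conjI allI impI)
  fix i j :: nat
  show "extended_sc i j = - extended_sc j i"
    using sc_antisym[of i j] \<omega>_antisym[of "e i" "e j"] unfolding extended_sc_def
    by (simp add: add.commute)
next
  fix i j :: nat assume ij: "2 \<le> i" "2 \<le> j" "i + j < n + 1"
  show "extended_sc (Suc i) j + extended_sc i (Suc j) = extended_sc i j"
  proof (cases "i + j = n")
    case True
    then have "br (e i) (e j) = sc i j *\<^sub>R e n"
      using br_e_split[OF ij(1,2)] T_beyond[of "Suc n"] by simp
    then have "\<omega> (e (Suc i)) (e j) + \<omega> (e i) (e (Suc j)) = sc i j * \<omega> (e 1) (e n)"
      using \<omega>_step[OF ij(1,2)] by (simp add: \<omega>_right)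
    then show ?thesis
      using True \<omega>_1_n unfolding extended_sc_def by (simp add: add_divide_distrib[symmetric])
  next
    case False
    then have "sc (Suc i) j + sc i (Suc j) = sc i j"
      using derivation_recurrence_step[OF derivation_recurrence_sc ij(1,2)] ij by simp
    then show ?thesis using False ij unfolding extended_sc_def by simp
  qed
qed

lemma \<omega>_bracket_top:
  assumes "2 \<le> i" "2 \<le> j" "2 \<le> l" "i + j + l = n + 1"
  shows "\<omega> (br (e i) (e j)) (e l) = extended_sc i j * extended_sc (i + j) l * \<omega> (e 1) (e n)"
proof -
  have "\<omega> (br (e i) (e j) - sc i j *\<^sub>R e (i + j)) (e l) = 0"
    by (rule \<omega>_left_vanishes[of _ "Suc (i + j)"])
       (use br_e_split[of i j] assms in \<open>auto intro!: \<omega>_above_antidiagonal\<close>)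
  then show ?thesis using assms \<omega>_1_n unfolding extended_sc_def by (simp add: \<omega>_left)
qed

lemma jacobi_relation_extended_sc:
  assumes "2 \<le> i" "2 \<le> j" "2 \<le> l" "i + j + l \<le> n + 1"
  shows "jacobi_relation extended_sc i j l"
proof (cases "i + j + l = n + 1")
  case True
  have "(extended_sc i j * extended_sc (i + j) l + extended_sc j l * extended_sc (j + l) i
      + extended_sc l i * extended_sc (l + i) j) * \<omega> (e 1) (e n) = 0"
    using \<omega>_closed[of "e i" "e j" "e l"] \<omega>_bracket_top[of i j l] \<omega>_bracket_top[of j l i]
      \<omega>_bracket_top[of l i j] assms True by (simp add: algebra_simps)
  then show ?thesis using \<omega>_1_n unfolding jacobi_relation_def by simp
next
  case False
  then show ?thesis
    using jacobi_sc[of i j l] assms unfolding jacobi_relation_def extended_sc_def by simp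
qed

text \<open>The extension has an odd top weight, at which no structure constant is zero, so the classification
of graded constants applies to it.\<close>

theorem sc_classification:
  assumes "12 \<le> n"
  obtains "\<And>i j. 2 \<le> i \<Longrightarrow> 2 \<le> j \<Longrightarrow> i + j \<le> n \<Longrightarrow> sc i j = 0"
  | c where "c \<noteq> 0" "\<And>i j. 2 \<le> i \<Longrightarrow> 2 \<le> j \<Longrightarrow> i + j \<le> n \<Longrightarrow> sc i j = c * witt_constant i j"
proof -
  have top: "extended_sc i (n + 1 - i) \<noteq> 0" if "2 \<le> i" "i + 2 \<le> n + 1" for i
    using \<omega>_antidiagonal_nonzero[of i] \<omega>_1_n that unfolding extended_sc_def by simp
  show ?thesis
  proof (rule graded_constants_classification[OF derivation_recurrence_extended_sc _ _
        jacobi_relation_extended_sc top])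
    show "odd (n + 1)" using even_n by simp
    show "13 \<le> n + 1" using assms by simp
  next
    assume "\<And>i j. 2 \<le> i \<Longrightarrow> 2 \<le> j \<Longrightarrow> i + j < n + 1 \<Longrightarrow> extended_sc i j = 0"
    then have "sc i j = 0" if "2 \<le> i" "2 \<le> j" "i + j \<le> n" for i j
      using that unfolding extended_sc_def by (metis Suc_eq_plus1 less_Suc_eq_le)
    then show ?thesis by (rule that(1))
  next
    fix c assume "c \<noteq> 0" and
      "\<And>i j. 2 \<le> i \<Longrightarrow> 2 \<le> j \<Longrightarrow> i + j \<le> n + 1 \<Longrightarrow> extended_sc i j = c * witt_constant i j"
    then have "sc i j = c * witt_constant i j" if "2 \<le> i" "2 \<le> j" "i + j \<le> n" for i j
      using that unfolding extended_sc_def by (metis le_SucI Suc_eq_plus1)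
    then show ?thesis by (rule that(2)[OF \<open>c \<noteq> 0\<close>])
  qed
qed

lemma bracket_tail:
  assumes "2 \<le> i" "2 \<le> j" "a = sc i j"
  shows "br (e i) (e j) - a *\<^sub>R e (i + j) \<in> T (Suc (i + j))"
  using br_e_split[OF assms(1,2)] assms(3) by simp

end

text \<open>The brackets with \<open>e\<^sub>1\<close> have no tail in this basis, so the constants \<open>c 1 i l\<close> can be taken to be
zero.\<close>

lemma m0_type_relationsI:
  assumes basis: "is_basis n e"
    and ad: "\<And>i. 2 \<le> i \<Longrightarrow> br (e 1) (e i) = e (Suc i)" and last: "e (Suc n) = 0"
    and br: "\<And>i j. 2 \<le> i \<Longrightarrow> 2 \<le> j \<Longrightarrow> br (e i) (e j) \<in> span (e ` {Suc (i + j)..n})"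
    and n: "2 \<le> n"
  shows "\<exists>c. m0_type_relations br n e c"
proof -
  have "\<exists>a. br (e i) (e j) = (\<Sum>l = 1..n - (i + j). a l *\<^sub>R e (i + j + l))" if "2 \<le> i" "2 \<le> j" for i j
    by (rule span_image_interval_sum[of _ 1]) (use basis br that in \<open>auto simp: is_basis_def\<close>)
  then obtain c where c: "\<And>i j. 2 \<le> i \<Longrightarrow> 2 \<le> j \<Longrightarrow>
      br (e i) (e j) = (\<Sum>l = 1..n - (i + j). c i j l *\<^sub>R e (i + j + l))"
    by metis
  have "m0_type_relations br n e (\<lambda>i j l. if i = 1 then 0 else c i j l)"
    unfolding m0_type_relations_def
  proof (intro conjI allI impI ballI)
    show "br (e 1) (e n) = 0" using ad[of n] last n by simp
    fix i j :: nat assume ij: "2 \<le> i \<and> i < j \<and> j \<le> n \<and> n < i + j"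
    then show "br (e i) (e j) = 0" using c[of i j] by simp
  next
    fix i j :: nat assume "2 \<le> i \<and> i < j \<and> j \<le> n \<and> i + j \<le> n"
    then show "br (e i) (e j) = (\<Sum>l = 1..n - i - j. (if i = 1 then 0 else c i j l) *\<^sub>R e (i + j + l))"
      using c[of i j] by simp
  qed (use ad in simp)
  then show ?thesis by blast
qed

lemma witt_type_relationsI:
  assumes basis: "is_basis n f"
    and br: "\<And>i j. 1 \<le> i \<Longrightarrow> i < j \<Longrightarrow> j \<le> n \<Longrightarrow>
      br (f i) (f j) - (if i + j \<le> n then (real j - real i) *\<^sub>R f (i + j) else 0) \<in> span (f ` {Suc (i + j)..n})"
  shows "\<exists>c. witt_type_relations br n f c"
proof -
  have "\<exists>a. br (f i) (f j) - (if i + j \<le> n then (real j - real i) *\<^sub>R f (i + j) else 0)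
      = (\<Sum>l = 1..n - (i + j). a l *\<^sub>R f (i + j + l))" if "1 \<le> i" "i < j" "j \<le> n" for i j
    by (rule span_image_interval_sum[of _ 1]) (use basis br that in \<open>auto simp: is_basis_def\<close>)
  then obtain c where c: "\<And>i j. 1 \<le> i \<Longrightarrow> i < j \<Longrightarrow> j \<le> n \<Longrightarrow>
      br (f i) (f j) - (if i + j \<le> n then (real j - real i) *\<^sub>R f (i + j) else 0)
      = (\<Sum>l = 1..n - (i + j). c i j l *\<^sub>R f (i + j + l))"
    by metis
  have "witt_type_relations br n f c"
    unfolding witt_type_relations_def
  proof (intro conjI allI impI)
    fix i j :: nat assume "1 \<le> i \<and> i < j \<and> j \<le> n \<and> i + j \<le> n"
    then show "br (f i) (f j) = (real j - real i) *\<^sub>R f (i + j) + (\<Sum>l = 1..n - i - j. c i j l *\<^sub>R f (i + j + l))"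
      using c[of i j] by (simp add: algebra_simps)
  next
    fix i j :: nat assume "1 \<le> i \<and> i < j \<and> j \<le> n \<and> n < i + j"
    then show "br (f i) (f j) = 0" using c[of i j] by simp
  qed
  then show ?thesis by blast
qed

context second_grading
begin

text \<open>Rescaling undoes the factorials of \<^const>\<open>witt_constant\<close>, and the factor \<open>1 / c\<close> on all basis
vectors but the first absorbs \<open>c\<close>: the product of two of them carries \<open>1 / c\<^sup>2\<close>, of which the
constant \<open>c\<close> leaves \<open>1 / c\<close>.\<close>

lemma witt_normalization:
  assumes c: "c \<noteq> 0"
    and sc: "\<And>i j. 2 \<le> i \<Longrightarrow> 2 \<le> j \<Longrightarrow> i + j \<le> n \<Longrightarrow> sc i j = c * witt_constant i j"
  shows "\<exists>f d. is_basis n f \<and> witt_type_relations br n f d"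
proof -
  define t where "t i = (if i = 1 then 1 else 1 / (c * fact (i - 2)))" for i :: nat
  define f where "f i = t i *\<^sub>R e i" for i
  have t: "t i \<noteq> 0" for i using c unfolding t_def by simp
  have finite_basis: "finite (e ` {1..n})" "span (e ` {1..n}) = UNIV"
    using basis unfolding is_basis_def by simp_all
  have dim: "dim (UNIV :: 'a set) = n"
    using basis dim_eq_card[of "e ` {1..n}" "UNIV :: 'a set"]
    unfolding is_basis_def by (simp add: card_image)
  have f_in: "f m \<in> T m" if "1 \<le> m" "m \<le> n" for m
    unfolding f_def by (intro subspace_scale[OF subspace_T] e_in_T order_refl)
  have f_notin: "f m \<notin> T (Suc m)" if "1 \<le> m" "m \<le> n" for m
    using coord_T[of m "f m"] coord_e[of m m] t[of m] that unfolding f_def by (auto simp: coord_scale)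
  have decr: "T (Suc m) \<subseteq> T m" for m by (rule T_antimono) simp
  have last: "T (Suc n) = {0}" by (rule T_beyond) simp
  have basis_f: "is_basis n f"
    by (rule flag_basis(1)[OF finite_basis dim subspace_T decr last f_in f_notin])
  have T_f: "T m = span (f ` {m..n})" if "1 \<le> m" "m \<le> Suc n" for m
    by (rule flag_basis(2)[OF finite_basis dim subspace_T decr last f_in f_notin that])
  have spans: "T m = span (f ` {m..n})" if "1 \<le> m" for m
    using T_f[OF that] T_beyond[of m] by (cases "m \<le> Suc n") auto
  have "br (f i) (f j) - (if i + j \<le> n then (real j - real i) *\<^sub>R f (i + j) else 0)
      \<in> span (f ` {Suc (i + j)..n})" if ij: "1 \<le> i" "i < j" "j \<le> n" for i j
  proof (cases "i = 1")
    case True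
    obtain a where a: "j = a + 2" using ij True by (metis add.commute le_Suc_ex Suc_leI Suc_1)
    have "t j = real (j - 1) * t (Suc j)" using c unfolding t_def a by (simp del: of_nat_Suc)
    then have "br (f i) (f j) = (real j - real i) *\<^sub>R f (i + j)"
      using ad_e1[of j] ij True unfolding f_def by (simp add: br_right t_def of_nat_diff)
    then show ?thesis using True ij beyond[of "i + j"] unfolding f_def by (auto simp: span_zero)
  next
    case False
    then have ij2: "2 \<le> i" "2 \<le> j" using ij by auto
    have "br (f i) (f j) - (t i * t j) *\<^sub>R sc i j *\<^sub>R e (i + j)
        = (t i * t j) *\<^sub>R (br (e i) (e j) - sc i j *\<^sub>R e (i + j))"
      unfolding f_def by (simp add: br_left br_right scaleR_diff_right)
    also have "\<dots> \<in> T (Suc (i + j))"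
      using bracket_tail[OF ij2 refl] by (rule subspace_scale[OF subspace_T])
    finally have tail: "br (f i) (f j) - (t i * t j) *\<^sub>R sc i j *\<^sub>R e (i + j) \<in> span (f ` {Suc (i + j)..n})"
      using spans[of "Suc (i + j)"] by simp
    show ?thesis
    proof (cases "i + j \<le> n")
      case True
      have "t i * t j * sc i j = (real j - real i) * t (i + j)"
        unfolding sc[OF ij2 True] using c ij2 unfolding t_def witt_constant_def
        by (simp add: field_simps)
      then show ?thesis using tail True unfolding f_def by simp
    next
      case False
      then show ?thesis using tail beyond[of "i + j"] by simp
    qed
  qed
  then show ?thesis using witt_type_relationsI[OF basis_f] basis_f by blast
qed

theorem symplectic_filiform_normal_forms:
  assumes "12 \<le> n"
  shows "\<exists>f c. is_basis n f \<and> (m0_type_relations br n f c \<or> witt_type_relations br n f c)"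
proof (rule sc_classification[OF assms])
  assume sc: "\<And>i j. 2 \<le> i \<Longrightarrow> 2 \<le> j \<Longrightarrow> i + j \<le> n \<Longrightarrow> sc i j = 0"
  have "br (e i) (e j) \<in> span (e ` {Suc (i + j)..n})" if ij: "2 \<le> i" "2 \<le> j" for i j
    using bracket_tail[OF ij refl] sc[OF ij] beyond[of "i + j"] unfolding T_def
    by (cases "i + j \<le> n") auto
  then have "\<exists>c. m0_type_relations br n e c"
    by (intro m0_type_relationsI) (use basis ad_e1 beyond n_ge in auto)
  then show ?thesis using basis by blast
next
  fix c assume "c \<noteq> 0" "\<And>i j. 2 \<le> i \<Longrightarrow> 2 \<le> j \<Longrightarrow> i + j \<le> n \<Longrightarrow> sc i j = c * witt_constant i j"
  then show ?thesis using witt_normalization by blast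
qed

end

section \<open>Symplectic filiform Lie algebras\<close>

theorem corollary3p6:
  fixes br :: "'a::real_vector \<Rightarrow> 'a \<Rightarrow> 'a" and k :: nat
  assumes "lie_algebra br"
    and "filiform br"
    and "symplectic br"
    and "dim (UNIV :: 'a set) = 2 * k"
    and "2 * k \<ge> 12"
  shows "\<exists>e c. is_basis (2 * k) e \<and>
           (m0_type_relations br (2 * k) e c \<or> witt_type_relations br (2 * k) e c)"
proof -
  interpret lie_algebra br by fact
  interpret filiform_lie_algebra br "2 * k"
    by unfold_locales (use assms in auto)
  obtain \<omega> where \<omega>: "symplectic_form br \<omega>"
    using assms(3) unfolding symplectic_def by blast
  obtain e where e: "is_basis (2 * k) e" "\<And>i. 2 \<le> i \<Longrightarrow> br (e 1) (e i) = e (Suc i)"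
    "\<And>i. 2 * k < i \<Longrightarrow> e i = 0"
    "\<And>i j. 2 \<le> i \<Longrightarrow> 2 \<le> j \<Longrightarrow> br (e i) (e j) \<in> span (e ` {i + j - 1..2 * k})"
    "br (e 2) (e 3) \<in> span (e ` {5..2 * k})"
    using adapted_basis_exists by blast
  interpret first: first_grading br "2 * k" e \<omega>
    by unfold_locales (use e \<omega> assms(5) in auto)
  interpret second: second_grading br "2 * k" e \<omega>
    using first.second_grading_basis unfolding second_grading_def .
  show ?thesis
    using second.symplectic_filiform_normal_forms assms(5) by blast
qed

end
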